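(* For any $N\ge2$, the linear span of $\mathfrak{B}_N$ coincides with $V_{\mathrm{geo}}^N$, and $\dim(V_{\mathrm{geo}}^N)=\mathrm{Card}(\mathfrak{M}_\circ^N)$.
   Context: Let $z_{(\vee,k)}$, $z_{(\circ,k)}$, $k\in\mathbb{N}$, be commuting variables. For a monomial $z^\beta=\prod_kz_{(\vee,k)}^{\beta(\vee,k)}z_{(\circ,k)}^{\beta(\circ,k)}$ ($\beta$ of finite support) set $[\beta]=\sum_{k\in\mathbb{N}}\big((1-k)\beta(\circ,k)-(1+k)\beta(\vee,k)\big)$. $\mathcal{M}_{\vee,\circ}$ is the real linear span of the monomials $z^\beta$ with $[\beta]=1$. $\mathfrak{M}_\circ^N$ is the set of monomials $z^\beta=\prod_kz_{(\circ,k)}^{\beta(\circ,k)}$ in the variables $z_{(\circ,k)}$ only, with $[\beta]=1$ and $\sum_k\beta(\circ,k)=N$. $D$ is the derivation (Leibniz rule) on polynomials in these variables with $Dz_{(\vee,k)}=z_{(\vee,k+1)}$ and $Dz_{(\circ,k)}=z_{(\circ,k+1)}$. For $v_1,v_2\in\mathcal{M}_{\vee,\circ}$ the combinatorial covariant derivative is $$\nabla_{v_1}v_2=v_1Dv_2+\tfrac12z_{(\vee,0)}v_1v_2\in\mathcal{M}_{\vee,\circ}.$$ The sets $\mathfrak{B}_N$ are defined by $\mathfrak{B}_1=\{z_{(\circ,0)}\}$ and, for $N\ge1$, $\mathfrak{B}_{N+1}=\{\nabla_vw:\ v\in\mathfrak{B}_k,\ w\in\mathfrak{B}_{N+1-k},\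 1\le k\le N\}$. For $f,g\in\mathcal{C}^\infty(\mathbb{R},\mathbb{R})$, $F_{f,g}$ is the linear, multiplicative map with $F_{f,g}(z_{(\circ,k)})=g^{(k)}$ and $F_{f,g}(z_{(\vee,k)})=2f^{(k)}$. For a diffeomorphism $\phi:\mathbb{R}\to\mathbb{R}$ homotopic to the identity and smooth $f,g,h$, define $\phi\cdot f$, $\phi\cdot g$, $\phi\cdot h$ by $$(\phi\cdot g)(\phi(u))=\phi'(u)g(u),\quad(\phi\cdot h)(\phi(u))=\phi'(u)h(u),\quad(\phi\cdot f)(\phi(u))(\phi'(u))^2=\phi'(u)f(u)-\phi''(u).$$ $V_{\mathrm{geo}}\subset\mathcal{M}_{\vee,\circ}$ is the subspace generated by those $v\in\mathcal{M}_{\vee,\circ}$ such that, for all smooth $f,g$ and all diffeomorphisms $\phi:\mathbb{R}\to\mathbb{R}$ homotopic to the identity, $$\phi\cdot F_{f,g}(v)=F_{\phi\cdot f,\phi\cdot g}(v),$$ where on the left-hand side $\phi$ acts on the function $F_{f,g}(v)$ by the rule for $h$. $V_{\mathrm{geo}}^N$ is the subspace of those elements of $V_{\mathrm{geo}}$ that are linear combinations of monomials containing exactly $N$ variables of type $z_{(\circ,k)}$ (counted with multiplicity), i.e. $\sum_k\beta(\circ,k)=N$. *)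

theory Defs
  imports "HOL-Analysis.Analysis" "HOL-Analysis.Finite_Function_Topology"
begin

section \<open>Polynomials in two families of variables\<close>

datatype zvar = Vee nat | Circ nat

text \<open>
  A monomial is given by its exponent vector \<open>\<beta>\<close> of finite support, and the real polynomials form
  the monoid algebra over the exponent vectors. The ring structure comes from
  \<open>Poly_Mapping\<close> and the real vector space structure from \<open>Finite_Function_Topology\<close>.
\<close>

type_synonym zexpo = "zvar \<Rightarrow>\<^sub>0 nat"
type_synonym zpoly = "zexpo \<Rightarrow>\<^sub>0 real"

definition zmon :: "zexpo \<Rightarrow> zpoly" where
  "zmon \<beta> = Poly_Mapping.single \<beta> 1"

definition Z :: "zvar \<Rightarrow> zpoly" where
  "Z x = zmon (Poly_Mapping.single x 1)"

fun var_degree :: "zvar \<Rightarrow> int" where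
  "var_degree (Circ k) = 1 - int k"
| "var_degree (Vee k) = - (1 + int k)"

definition bracket :: "zexpo \<Rightarrow> int" where
  "bracket \<beta> = (\<Sum>x\<in>Poly_Mapping.keys \<beta>. var_degree x * int (Poly_Mapping.lookup \<beta> x))"

fun is_circ :: "zvar \<Rightarrow> bool" where
  "is_circ (Circ k) = True"
| "is_circ (Vee k) = False"

definition circ_count :: "zexpo \<Rightarrow> nat" where
  "circ_count \<beta> = (\<Sum>x\<in>{x \<in> Poly_Mapping.keys \<beta>. is_circ x}. Poly_Mapping.lookup \<beta> x)"

definition M_space :: "zpoly set" where
  "M_space = span {zmon \<beta> | \<beta>. bracket \<beta> = 1}"

definition M_circ :: "nat \<Rightarrow> zpoly set" where
  "M_circ N = {zmon \<beta> | \<beta>. (\<forall>k. Poly_Mapping.lookup \<beta> (Vee k) = 0) \<and> bracket \<beta> = 1 \<and> circ_count \<beta> = N}"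


section \<open>Linear extension from monomials\<close>

definition lin_ext :: "(zexpo \<Rightarrow> 'b::real_vector) \<Rightarrow> zpoly \<Rightarrow> 'b" where
  "lin_ext h p = (\<Sum>\<beta>\<in>Poly_Mapping.keys p. Poly_Mapping.lookup p \<beta> *\<^sub>R h \<beta>)"

lemma lookup_scaleR_poly: "Poly_Mapping.lookup (c *\<^sub>R p) \<beta> = c *\<^sub>R Poly_Mapping.lookup p \<beta>"
proof -
  have "finite {i. c *\<^sub>R Poly_Mapping.lookup p i \<noteq> 0}"
    by (rule finite_subset[OF _ finite_lookup[of p]]) auto
  then show ?thesis
    by (simp add: scaleR_poly_mapping_def)
qed

lemma lin_ext_superset:
  assumes "finite S" "Poly_Mapping.keys p \<subseteq> S"
  shows "lin_ext h p = (\<Sum>\<beta>\<in>S. Poly_Mapping.lookup p \<beta> *\<^sub>R h \<beta>)"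
  unfolding lin_ext_def using assms
  by (intro sum.mono_neutral_left) (auto simp: in_keys_iff)

lemma lin_ext_add: "lin_ext h (p + q) = lin_ext h p + lin_ext h q"
proof -
  let ?S = "Poly_Mapping.keys p \<union> Poly_Mapping.keys q"
  have "lin_ext h (p + q) = (\<Sum>\<beta>\<in>?S. Poly_Mapping.lookup (p + q) \<beta> *\<^sub>R h \<beta>)"
    by (rule lin_ext_superset) (auto simp: Poly_Mapping.keys_add)
  also have "\<dots> = (\<Sum>\<beta>\<in>?S. Poly_Mapping.lookup p \<beta> *\<^sub>R h \<beta>) + (\<Sum>\<beta>\<in>?S. Poly_Mapping.lookup q \<beta> *\<^sub>R h \<beta>)"
    by (simp add: lookup_add scaleR_add_left sum.distrib)
  also have "\<dots> = lin_ext h p + lin_ext h q"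
    by (simp add: lin_ext_superset[of ?S])
  finally show ?thesis .
qed

lemma lin_ext_scaleR: "lin_ext h (c *\<^sub>R p) = c *\<^sub>R lin_ext h p"
proof -
  have "lin_ext h (c *\<^sub>R p) = (\<Sum>\<beta>\<in>Poly_Mapping.keys p. Poly_Mapping.lookup (c *\<^sub>R p) \<beta> *\<^sub>R h \<beta>)"
    by (rule lin_ext_superset) (auto simp: in_keys_iff lookup_scaleR_poly)
  then show ?thesis
    by (simp add: lin_ext_def lookup_scaleR_poly scaleR_sum_right)
qed

lemma lin_ext_zmon [simp]: "lin_ext h (zmon \<beta>) = h \<beta>"
  by (simp add: lin_ext_def zmon_def)

lemma lin_ext_0 [simp]: "lin_ext h 0 = 0"
  by (simp add: lin_ext_def)

lemma zmon_mult: "zmon \<alpha> * zmon \<beta> = zmon (\<alpha> + \<beta>)"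
  by (simp add: zmon_def mult_single)

lemma scaleR_mult_left_poly: "(c *\<^sub>R p) * q = c *\<^sub>R (p * q)" for p q :: zpoly
proof -
  have *: "c *\<^sub>R r = Poly_Mapping.single 0 c * r" for r :: zpoly
  proof (rule poly_mapping_eqI)
    fix \<beta>
    show "Poly_Mapping.lookup (c *\<^sub>R r) \<beta> = Poly_Mapping.lookup (Poly_Mapping.single 0 c * r) \<beta>"
      by (simp add: lookup_scaleR_poly map.rep_eq when_def flip: mult_map_scale_conv_mult)
  qed
  show ?thesis
    by (simp add: * mult.assoc)
qed

lemma scaleR_mult_right_poly: "p * (c *\<^sub>R q) = c *\<^sub>R (p * q)" for p q :: zpoly
  using scaleR_mult_left_poly[of c q p] by (simp add: mult.commute)

lemma zpoly_induct [case_names zero zmon add]: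
  fixes p :: zpoly
  assumes "P 0" "\<And>c \<beta>. P (c *\<^sub>R zmon \<beta>)" "\<And>p q. P p \<Longrightarrow> P q \<Longrightarrow> P (p + q)"
  shows "P p"
proof -
  have "p = lin_ext zmon p"
    by (rule poly_mapping_eqI)
      (auto simp: lin_ext_def lookup_sum lookup_scaleR_poly zmon_def lookup_single when_def
        if_distrib in_keys_iff cong: if_cong)
  moreover have "P (\<Sum>\<beta>\<in>S. Poly_Mapping.lookup p \<beta> *\<^sub>R zmon \<beta>)" if "finite S" for S
    using that by induction (auto intro: assms)
  ultimately show ?thesis
    by (metis finite_keys lin_ext_def)
qed


section \<open>The derivation \<open>D\<close>, the covariant derivative and the generated sets\<close>

fun shift :: "zvar \<Rightarrow> zvar" where
  "shift (Vee k) = Vee (Suc k)"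
| "shift (Circ k) = Circ (Suc k)"

definition D_zmon :: "zexpo \<Rightarrow> zpoly" where
  "D_zmon \<beta> = (\<Sum>x\<in>Poly_Mapping.keys \<beta>. real (Poly_Mapping.lookup \<beta> x) *\<^sub>R
     zmon (\<beta> - Poly_Mapping.single x 1 + Poly_Mapping.single (shift x) 1))"

definition Dz :: "zpoly \<Rightarrow> zpoly" where
  "Dz = lin_ext D_zmon"

text \<open>\<open>D_add\<close>, \<open>D_scaleR\<close>, \<open>D_Z\<close> and \<open>D_mult\<close> determine \<^const>\<open>Dz\<close> as the derivation
  that raises the index of every variable by one.\<close>

lemma D_add: "Dz (p + q) = Dz p + Dz q"
  by (simp add: Dz_def lin_ext_add)

lemma D_scaleR: "Dz (c *\<^sub>R p) = c *\<^sub>R Dz p"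
  by (simp add: Dz_def lin_ext_scaleR)

lemma D_Z: "Dz (Z x) = Z (shift x)"
  by (simp add: Dz_def Z_def D_zmon_def)

lemma D_zmon_superset:
  assumes "finite S" "Poly_Mapping.keys \<beta> \<subseteq> S"
  shows "D_zmon \<beta> = (\<Sum>x\<in>S. real (Poly_Mapping.lookup \<beta> x) *\<^sub>R
     zmon (\<beta> - Poly_Mapping.single x 1 + Poly_Mapping.single (shift x) 1))"
  unfolding D_zmon_def using assms
  by (intro sum.mono_neutral_left) (auto simp: in_keys_iff)

lemma D_zmon_mult: "D_zmon (\<alpha> + \<beta>) = D_zmon \<alpha> * zmon \<beta> + zmon \<alpha> * D_zmon \<beta>"
proof -
  let ?S = "Poly_Mapping.keys \<alpha> \<union> Poly_Mapping.keys \<beta>"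
  let ?e = "\<lambda>x. Poly_Mapping.single x (1::nat)"
  have sub: "\<alpha> + \<beta> - ?e x = (\<alpha> - ?e x) + \<beta>" if "Poly_Mapping.lookup \<alpha> x > 0" for \<alpha> \<beta> :: zexpo and x
    using that by (intro poly_mapping_eqI) (auto simp: lookup_add lookup_minus lookup_single when_def)
  have A: "real (Poly_Mapping.lookup \<alpha> x) *\<^sub>R zmon (\<alpha> + \<beta> - ?e x + ?e (shift x))
      = (real (Poly_Mapping.lookup \<alpha> x) *\<^sub>R zmon (\<alpha> - ?e x + ?e (shift x))) * zmon \<beta>"
    for \<alpha> \<beta> :: zexpo and x
  proof (cases "Poly_Mapping.lookup \<alpha> x = 0")
    case False
    then have "\<alpha> + \<beta> - ?e x + ?e (shift x) = \<alpha> - ?e x + ?e (shift x) + \<beta>"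
      by (subst sub) (simp_all add: ac_simps)
    then show ?thesis
      by (simp only: scaleR_mult_left_poly zmon_mult)
  qed simp
  have "D_zmon (\<alpha> + \<beta>) = (\<Sum>x\<in>?S. real (Poly_Mapping.lookup (\<alpha> + \<beta>) x) *\<^sub>R zmon (\<alpha> + \<beta> - ?e x + ?e (shift x)))"
    by (rule D_zmon_superset) (auto simp: Poly_Mapping.keys_add)
  also have "\<dots> = (\<Sum>x\<in>?S. real (Poly_Mapping.lookup \<alpha> x) *\<^sub>R zmon (\<alpha> + \<beta> - ?e x + ?e (shift x)))
     + (\<Sum>x\<in>?S. real (Poly_Mapping.lookup \<beta> x) *\<^sub>R zmon (\<beta> + \<alpha> - ?e x + ?e (shift x)))"
    by (simp add: lookup_add scaleR_add_left sum.distrib add.commute)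
  also have "\<dots> = D_zmon \<alpha> * zmon \<beta> + D_zmon \<beta> * zmon \<alpha>"
    by (simp only: A sum_distrib_right D_zmon_superset[of ?S] finite_Un finite_keys Un_upper1 Un_upper2 simp_thms)
  finally show ?thesis
    by (simp add: mult.commute)
qed

lemma D_mult: "Dz (p * q) = Dz p * q + p * Dz q"
proof (induction p rule: zpoly_induct)
  case (zmon c \<beta>)
  show ?case
  proof (induction q rule: zpoly_induct)
    case (zmon d \<gamma>)
    have "Dz (zmon \<beta> * zmon \<gamma>) = Dz (zmon \<beta>) * zmon \<gamma> + zmon \<beta> * Dz (zmon \<gamma>)"
      by (simp add: Dz_def zmon_mult D_zmon_mult)
    then show ?case
      by (simp add: D_scaleR scaleR_mult_left_poly scaleR_mult_right_poly scaleR_add_right)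
  qed (simp_all add: D_add distrib_left, simp add: Dz_def)
qed (simp_all add: D_add distrib_right, simp add: Dz_def)

definition nabla :: "zpoly \<Rightarrow> zpoly \<Rightarrow> zpoly" where
  "nabla v w = v * Dz w + (1 / 2) *\<^sub>R (Z (Vee 0) * v * w)"

fun BB :: "nat \<Rightarrow> zpoly set" where
  "BB 0 = {}"
| "BB (Suc 0) = {Z (Circ 0)}"
| "BB (Suc (Suc n)) = (\<Union>k\<in>{1..Suc n}. (\<lambda>(v, w). nabla v w) ` (BB k \<times> BB (Suc (Suc n) - k)))"

lemma B_Suc:
  assumes "N \<ge> 1"
  shows "BB (N + 1) = {nabla v w | v w k. v \<in> BB k \<and> w \<in> BB (N + 1 - k) \<and> 1 \<le> k \<and> k \<le> N}"
  using assms by (cases N) force+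


section \<open>The evaluation maps\<close>

definition smooth :: "(real \<Rightarrow> real) \<Rightarrow> bool" where
  "smooth f \<longleftrightarrow> (\<forall>n x. (deriv ^^ n) f field_differentiable at x)"

fun F_var :: "(real \<Rightarrow> real) \<Rightarrow> (real \<Rightarrow> real) \<Rightarrow> zvar \<Rightarrow> real \<Rightarrow> real" where
  "F_var f g (Circ k) u = (deriv ^^ k) g u"
| "F_var f g (Vee k) u = 2 * (deriv ^^ k) f u"

definition FF :: "(real \<Rightarrow> real) \<Rightarrow> (real \<Rightarrow> real) \<Rightarrow> zpoly \<Rightarrow> real \<Rightarrow> real" where
  "FF f g p u = lin_ext (\<lambda>\<beta>. \<Prod>x\<in>Poly_Mapping.keys \<beta>. F_var f g x u ^ Poly_Mapping.lookup \<beta> x) p"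

text \<open>\<open>F_add\<close>, \<open>F_scaleR\<close>, \<open>F_one\<close>, \<open>F_Z\<close> and \<open>F_mult\<close> determine \<open>FF f g\<close> as the linear, multiplicative map with the prescribed
  values on the variables.\<close>

lemma F_add: "FF f g (p + q) u = FF f g p u + FF f g q u"
  by (simp add: FF_def lin_ext_add)

lemma F_scaleR: "FF f g (c *\<^sub>R p) u = c * FF f g p u"
  by (simp add: FF_def lin_ext_scaleR)

lemma F_one: "FF f g 1 u = 1"
  by (simp add: FF_def lin_ext_def)

lemma F_Z: "FF f g (Z x) u = F_var f g x u"
  by (simp add: FF_def Z_def)

lemma F_mult: "FF f g (p * q) u = FF f g p u * FF f g q u"
proof (induction p rule: zpoly_induct)
  case (zmon c \<beta>)
  show ?case
  proof (induction q rule: zpoly_induct)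
    case (zmon d \<gamma>)
    let ?P = "\<lambda>S \<beta>. \<Prod>x\<in>S. F_var f g x u ^ Poly_Mapping.lookup \<beta> x"
    let ?S = "Poly_Mapping.keys \<beta> \<union> Poly_Mapping.keys \<gamma>"
    have ext: "?P (Poly_Mapping.keys \<delta>) \<delta> = ?P ?S \<delta>" if "Poly_Mapping.keys \<delta> \<subseteq> ?S" for \<delta> :: zexpo
      using that by (intro prod.mono_neutral_left) (auto simp: in_keys_iff)
    have "FF f g (zmon \<beta> * zmon \<gamma>) u = FF f g (zmon \<beta>) u * FF f g (zmon \<gamma>) u"
      unfolding FF_def zmon_mult lin_ext_zmon
        ext[OF Poly_Mapping.keys_add] ext[OF Un_upper1] ext[OF Un_upper2]
      by (simp add: lookup_add power_add prod.distrib)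
    then show ?case
      by (simp add: F_scaleR scaleR_mult_left_poly scaleR_mult_right_poly)
  qed (simp_all add: F_add distrib_left, simp add: FF_def)
qed (simp_all add: F_add distrib_right, simp add: FF_def)


section \<open>Diffeomorphisms and geometric elements\<close>

definition diffeo :: "(real \<Rightarrow> real) \<Rightarrow> bool" where
  "diffeo \<phi> \<longleftrightarrow> bij \<phi> \<and> smooth \<phi> \<and> smooth (inv \<phi>)"

text \<open>
  The actions are given in solved form, i.e. at the point \<open>y = \<phi>(u)\<close>; the lemmas \<open>act_vec_apply\<close>
  and \<open>act_conn_apply\<close> recover the implicit identities that characterise them. The action
  \<open>act_vec\<close> is the one on \<open>g\<close> and \<open>h\<close>, and \<open>act_conn\<close> the one on \<open>f\<close>.
\<close>

definition act_vec :: "(real \<Rightarrow> real) \<Rightarrow> (real \<Rightarrow> real) \<Rightarrow> real \<Rightarrow> real" where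
  "act_vec \<phi> h y = (let u = inv \<phi> y in deriv \<phi> u * h u)"

definition act_conn :: "(real \<Rightarrow> real) \<Rightarrow> (real \<Rightarrow> real) \<Rightarrow> real \<Rightarrow> real" where
  "act_conn \<phi> f y = (let u = inv \<phi> y in (deriv \<phi> u * f u - deriv (deriv \<phi>) u) / (deriv \<phi> u)\<^sup>2)"

lemma smooth_DERIV:
  assumes "smooth f"
  shows "(f has_field_derivative deriv f x) (at x)"
  using assms[unfolded smooth_def, rule_format, of 0 x] by (simp add: DERIV_deriv_iff_field_differentiable)

lemma diffeo_deriv_nonzero:
  assumes "diffeo \<phi>"
  shows "deriv \<phi> u \<noteq> 0"
proof
  assume 0: "deriv \<phi> u = 0"
  have "((inv \<phi> \<circ> \<phi>) has_field_derivative deriv (inv \<phi>) (\<phi> u) * deriv \<phi> u) (at u)"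
    using assms by (intro DERIV_chain smooth_DERIV) (auto simp: diffeo_def)
  moreover have "inv \<phi> \<circ> \<phi> = id"
    using assms by (simp add: diffeo_def bij_def)
  ultimately have "((\<lambda>x. x) has_field_derivative 0) (at u)"
    by (simp add: 0 id_def)
  then show False
    using DERIV_unique[OF _ DERIV_ident] by fastforce
qed

lemma act_vec_apply:
  assumes "diffeo \<phi>"
  shows "act_vec \<phi> h (\<phi> u) = deriv \<phi> u * h u"
  using assms by (simp add: act_vec_def diffeo_def bij_def)

lemma act_conn_apply:
  assumes "diffeo \<phi>"
  shows "act_conn \<phi> f (\<phi> u) * (deriv \<phi> u)\<^sup>2 = deriv \<phi> u * f u - deriv (deriv \<phi>) u"
  using assms diffeo_deriv_nonzero[OF assms, of u] by (simp add: act_conn_def diffeo_def bij_def)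

text \<open>
  Homotopy to the identity is meant in the usual topological sense, through continuous maps
  \<open>\<real> \<rightarrow> \<real>\<close>, not isotopy through diffeomorphisms.
\<close>

definition V_geo :: "zpoly set" where
  "V_geo = span {v \<in> M_space. \<forall>f g \<phi>. smooth f \<longrightarrow> smooth g \<longrightarrow> diffeo \<phi> \<longrightarrow>
     homotopic_with_canon (\<lambda>_. True) UNIV UNIV \<phi> id \<longrightarrow>
     act_vec \<phi> (FF f g v) = FF (act_conn \<phi> f) (act_vec \<phi> g) v}"

definition V_geo_N :: "nat \<Rightarrow> zpoly set" where
  "V_geo_N N = V_geo \<inter> span {zmon \<beta> | \<beta>. circ_count \<beta> = N}"

end

theory Submission
  imports Defs
begin

text \<open>
  On the line every connection is flat. The diffeomorphism \<open>\<phi>\<close> with \<open>\<phi>' = exp F\<close> transforms the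
  connection \<open>f = F'\<close> into \<open>0\<close>, so the value of a geometric element at \<open>(f, g)\<close> is determined by
  its values at connection \<open>0\<close>. The functions \<open>F\<close> that are bounded, which makes \<open>\<phi>\<close> surjective,
  have arbitrary finite jets at a point, and a polynomial vanishing on all jets is zero. Hence a
  geometric element is determined by its part free of the variables of type \<open>\<or>\<close>: this is
  \<open>geometric_flat_zero\<close>. It bounds the dimension of \<open>V_geo_N N\<close> by the number of monomials in
  \<open>M_circ N\<close>.

  Conversely, the iterated covariant derivatives of \<open>z\<^sub>(\<^sub>\<circ>\<^sub>,\<^sub>0\<^sub>)\<close> are geometric
  (\<open>geometric_nabla\<close>: the usual transformation rule of a connection), and their parts free of
  \<open>\<or>\<close> span everything. There the covariant derivative becomes the operation \<open>v \<cdot> D w\<close>, under which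
  the single variable \<open>z\<^sub>(\<^sub>\<circ>\<^sub>,\<^sub>0\<^sub>)\<close> generates every circle monomial of bracket \<open>1\<close>, by a Leibniz rule
  induction on the number of factors (\<open>circ_monomial_in_flat_span\<close>). Thus setting the
  variables of type \<open>\<or>\<close> to zero is an isomorphism from \<open>V_geo_N N\<close> onto the span of \<open>M_circ N\<close>
  that is already surjective on \<open>span (BB N)\<close>, which gives both claims.
\<close>

section \<open>Calculus of smooth functions\<close>

text \<open>
  Smoothness is the largest class of differentiable functions closed under differentiation, so any
  class closed in this sense consists of smooth functions.
\<close>

lemma smooth_coinduct:
  assumes "f \<in> S"
    and "\<And>h. h \<in> S \<Longrightarrow> \<exists>h'\<in>S. \<forall>x. (h has_real_derivative h' x) (at x)"
  shows "smooth f"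
proof -
  have step: "deriv h \<in> S \<and> h field_differentiable at x" if "h \<in> S" for h x
  proof -
    obtain h' where h': "h' \<in> S" "\<And>x. (h has_real_derivative h' x) (at x)"
      using assms(2)[OF \<open>h \<in> S\<close>] by blast
    then have "deriv h = h'"
      by (intro ext DERIV_imp_deriv)
    then show ?thesis
      using h' by (auto simp: field_differentiable_def)
  qed
  have "(deriv ^^ n) f \<in> S" for n
    by (induction n) (use assms(1) step in auto)
  then show ?thesis
    using step by (simp add: smooth_def)
qed

lemma smooth_funpow_deriv: "smooth f \<Longrightarrow> smooth ((deriv ^^ n) f)"
  by (simp add: smooth_def flip: funpow_add[unfolded o_def, THEN fun_cong])

lemma smooth_deriv: "smooth f \<Longrightarrow> smooth (deriv f)"
  using smooth_funpow_deriv[of f 1] by simp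

lemma DERIV_funpow_deriv:
  "smooth f \<Longrightarrow> ((deriv ^^ n) f has_real_derivative (deriv ^^ Suc n) f x) (at x)"
  using smooth_DERIV[OF smooth_funpow_deriv] by simp

lemma smooth_const: "smooth (\<lambda>_. c)"
proof (rule smooth_coinduct[of _ "{\<lambda>_. c, \<lambda>_. 0}"])
  fix h :: "real \<Rightarrow> real"
  assume "h \<in> {\<lambda>_. c, \<lambda>_. 0}"
  then have "\<forall>x. (h has_real_derivative 0) (at x)"
    by auto
  then show "\<exists>h'\<in>{\<lambda>_. c, \<lambda>_. 0}. \<forall>x. (h has_real_derivative h' x) (at x)"
    by auto
qed simp

lemma smooth_ident: "smooth (\<lambda>x. x)"
proof (rule smooth_coinduct[of _ "insert (\<lambda>x. x) (range (\<lambda>c _. c))"])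
  fix h :: "real \<Rightarrow> real"
  assume "h \<in> insert (\<lambda>x. x) (range (\<lambda>c _. c))"
  then obtain c where "\<forall>x. (h has_real_derivative c) (at x)"
    by (auto intro: DERIV_ident DERIV_const)
  then show "\<exists>h'\<in>insert (\<lambda>x. x) (range (\<lambda>c _. c)). \<forall>x. (h has_real_derivative h' x) (at x)"
    by (intro bexI[of _ "\<lambda>_. c"]) auto
qed simp

lemma smooth_exp: "smooth exp"
  by (rule smooth_coinduct[of _ "{exp}"]) (auto intro: DERIV_exp)

text \<open>
  The usual closure properties are proved simultaneously: the derivative of a sum, product,
  reciprocal or composite is again built from smooth functions by these same operations, so
  coinduction applies to the whole class at once and no formula for higher derivatives is needed.
\<close>

inductive_set smooth_terms :: "(real \<Rightarrow> real) set" where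
  base: "smooth h \<Longrightarrow> h \<in> smooth_terms"
| add: "a \<in> smooth_terms \<Longrightarrow> b \<in> smooth_terms \<Longrightarrow> (\<lambda>x. a x + b x) \<in> smooth_terms"
| mult: "a \<in> smooth_terms \<Longrightarrow> b \<in> smooth_terms \<Longrightarrow> (\<lambda>x. a x * b x) \<in> smooth_terms"
| inverse: "a \<in> smooth_terms \<Longrightarrow> (\<And>x. a x \<noteq> 0) \<Longrightarrow> (\<lambda>x. inverse (a x)) \<in> smooth_terms"
| compose: "smooth h \<Longrightarrow> a \<in> smooth_terms \<Longrightarrow> (\<lambda>x. h (a x)) \<in> smooth_terms"

lemma smooth_terms_deriv:
  assumes "a \<in> smooth_terms"
  shows "\<exists>a'\<in>smooth_terms. \<forall>x. (a has_real_derivative a' x) (at x)"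
  using assms
proof induction
  case (base h)
  then show ?case
    using smooth_DERIV smooth_deriv smooth_terms.base by blast
next
  case (add a b)
  then obtain a' b' where "a' \<in> smooth_terms" "b' \<in> smooth_terms"
    "\<And>x. (a has_real_derivative a' x) (at x)" "\<And>x. (b has_real_derivative b' x) (at x)"
    by blast
  then show ?case
    by (intro bexI[of _ "\<lambda>x. a' x + b' x"]) (auto intro!: smooth_terms.add DERIV_add)
next
  case (mult a b)
  then obtain a' b' where "a' \<in> smooth_terms" "b' \<in> smooth_terms"
    "\<And>x. (a has_real_derivative a' x) (at x)" "\<And>x. (b has_real_derivative b' x) (at x)"
    by blast
  with mult show ?case
    by (intro bexI[of _ "\<lambda>x. a' x * b x + b' x * a x"])
      (auto intro!: smooth_terms.add smooth_terms.mult DERIV_mult)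
next
  case (inverse a)
  then obtain a' where a': "a' \<in> smooth_terms" "\<And>x. (a has_real_derivative a' x) (at x)"
    by blast
  let ?i = "\<lambda>x. inverse (a x)"
  have "?i \<in> smooth_terms"
    using inverse by (intro smooth_terms.inverse)
  then have "(\<lambda>x. -1 * (a' x * (?i x * ?i x))) \<in> smooth_terms"
    using a' by (intro smooth_terms.mult smooth_terms.base[OF smooth_const])
  moreover have "(?i has_real_derivative -1 * (a' x * (?i x * ?i x))) (at x)" for x
    using DERIV_inverse_fun[OF a'(2) inverse.hyps(2), of x]
    by (simp add: power2_eq_square)
  ultimately show ?case
    by (intro bexI[of _ "\<lambda>x. -1 * (a' x * (?i x * ?i x))"]) auto
next
  case (compose h a)
  then obtain a' where a': "a' \<in> smooth_terms" "\<And>x. (a has_real_derivative a' x) (at x)"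
    by blast
  have "(\<lambda>x. deriv h (a x) * a' x) \<in> smooth_terms"
    by (rule smooth_terms.mult[OF smooth_terms.compose[OF smooth_deriv]]) (fact compose.hyps a'(1))+
  moreover have "((\<lambda>x. h (a x)) has_real_derivative deriv h (a x) * a' x) (at x)" for x
    using DERIV_chain2[OF smooth_DERIV[OF compose.hyps(1)] a'(2)] .
  ultimately show ?case
    by (intro bexI[of _ "\<lambda>x. deriv h (a x) * a' x"]) auto
qed

lemma smooth_terms_smooth: "a \<in> smooth_terms \<Longrightarrow> smooth a"
  using smooth_coinduct smooth_terms_deriv by blast

lemma smooth_add: "smooth a \<Longrightarrow> smooth b \<Longrightarrow> smooth (\<lambda>x. a x + b x)"
  and smooth_mult: "smooth a \<Longrightarrow> smooth b \<Longrightarrow> smooth (\<lambda>x. a x * b x)"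
  and smooth_inverse: "smooth a \<Longrightarrow> (\<And>x. a x \<noteq> 0) \<Longrightarrow> smooth (\<lambda>x. inverse (a x))"
  and smooth_compose: "smooth h \<Longrightarrow> smooth a \<Longrightarrow> smooth (\<lambda>x. h (a x))"
  by (blast intro: smooth_terms_smooth smooth_terms.intros)+

lemma smooth_diff: "smooth a \<Longrightarrow> smooth b \<Longrightarrow> smooth (\<lambda>x. a x - b x)"
  using smooth_add[of a "\<lambda>x. -1 * b x"] smooth_mult[OF smooth_const[of "-1"], of b] by simp

lemma smooth_power: "smooth a \<Longrightarrow> smooth (\<lambda>x. a x ^ n)"
  by (induction n) (auto intro: smooth_mult smooth_const)

text \<open>
  The functions \<open>h \<circ> \<psi>\<close> with \<open>h\<close> smooth have derivatives \<open>(h' r) \<circ> \<psi>\<close> of the same form. The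
  inverse of a diffeomorphism \<open>\<phi>\<close> solves the equation with \<open>r = 1 / \<phi>'\<close>.
\<close>

lemma smooth_autonomous_ode:
  assumes "smooth r" "\<And>y. (\<psi> has_real_derivative r (\<psi> y)) (at y)"
  shows "smooth \<psi>"
proof (rule smooth_coinduct[of _ "{\<lambda>y. h (\<psi> y) | h. smooth h}"])
  show "\<psi> \<in> {\<lambda>y. h (\<psi> y) | h. smooth h}"
    using smooth_ident by auto
next
  fix k assume "k \<in> {\<lambda>y. h (\<psi> y) | h. smooth h}"
  then obtain h where h: "smooth h" "k = (\<lambda>y. h (\<psi> y))"
    by blast
  then have "\<forall>y. (k has_real_derivative (\<lambda>x. deriv h x * r x) (\<psi> y)) (at y)"
    using DERIV_chain2[OF smooth_DERIV assms(2)] by auto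
  moreover have "smooth (\<lambda>x. deriv h x * r x)"
    using h assms by (intro smooth_mult smooth_deriv)
  ultimately show "\<exists>k'\<in>{\<lambda>y. h (\<psi> y) | h. smooth h}. \<forall>y. (k has_real_derivative k' y) (at y)"
    by (intro bexI[of _ "\<lambda>y. deriv h (\<psi> y) * r (\<psi> y)"])
      (auto intro!: exI[of _ "\<lambda>x. deriv h x * r x"])
qed

lemma funpow_deriv_eqI:
  assumes "h 0 = f" "\<And>n x. (h n has_real_derivative h (Suc n) x) (at x)"
  shows "(deriv ^^ n) f = h n"
proof (induction n)
  case (Suc n)
  have "deriv (h n) = h (Suc n)"
    by (rule ext) (intro DERIV_imp_deriv assms)
  with Suc show ?case
    by simp
qed (simp add: assms)

section \<open>Functions and diffeomorphisms with prescribed jets\<close>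

lemma funpow_deriv_zero: "(deriv ^^ n) (\<lambda>_. 0 :: real) = (\<lambda>_. 0)"
  by (rule funpow_deriv_eqI[of "\<lambda>_ _. 0"]) auto

lemma funpow_deriv_add_cmult:
  assumes "smooth f" "smooth g"
  shows "(deriv ^^ n) (\<lambda>x. f x + c * g x) = (\<lambda>x. (deriv ^^ n) f x + c * (deriv ^^ n) g x)"
proof (rule funpow_deriv_eqI)
  fix n x
  show "((\<lambda>x. (deriv ^^ n) f x + c * (deriv ^^ n) g x) has_real_derivative
      (deriv ^^ Suc n) f x + c * (deriv ^^ Suc n) g x) (at x)"
    by (intro DERIV_add DERIV_cmult DERIV_funpow_deriv assms)
qed simp

lemma funpow_deriv_ident_mult:
  assumes "smooth w"
  shows "(deriv ^^ n) (\<lambda>x. x * w x) = (\<lambda>x. x * (deriv ^^ n) w x + n * (deriv ^^ (n - 1)) w x)"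
proof (rule funpow_deriv_eqI)
  fix n :: nat and x :: real
  have "((\<lambda>x. x * (deriv ^^ n) w x) has_real_derivative
      1 * (deriv ^^ n) w x + (deriv ^^ Suc n) w x * x) (at x)"
    by (intro DERIV_mult DERIV_ident DERIV_funpow_deriv assms)
  moreover have "((\<lambda>x. n * (deriv ^^ (n - 1)) w x) has_real_derivative n * (deriv ^^ n) w x) (at x)"
    using DERIV_cmult[OF DERIV_funpow_deriv[OF assms], of n "n - 1" x] by (cases n) auto
  ultimately have "((\<lambda>x. x * (deriv ^^ n) w x + n * (deriv ^^ (n - 1)) w x) has_real_derivative
      1 * (deriv ^^ n) w x + (deriv ^^ Suc n) w x * x + n * (deriv ^^ n) w x) (at x)"
    by (rule DERIV_add)
  also have "1 * (deriv ^^ n) w x + (deriv ^^ Suc n) w x * x + n * (deriv ^^ n) w x =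
      x * (deriv ^^ Suc n) w x + Suc n * (deriv ^^ (Suc n - 1)) w x"
    by (simp add: distrib_right mult.commute)
  finally show "((\<lambda>x. x * (deriv ^^ n) w x + n * (deriv ^^ (n - 1)) w x) has_real_derivative
      x * (deriv ^^ Suc n) w x + Suc n * (deriv ^^ (Suc n - 1)) w x) (at x)" .
qed simp

lemma funpow_deriv_power_mult_0:
  assumes "smooth w" "n \<le> m"
  shows "(deriv ^^ n) (\<lambda>x. x ^ m * w x) 0 = (if n = m then fact m * w 0 else 0)"
  using assms(2)
proof (induction m arbitrary: n)
  case (Suc m)
  have "smooth (\<lambda>x. x ^ m * w x)"
    by (intro smooth_mult smooth_power smooth_ident assms)
  from funpow_deriv_ident_mult[OF this, of n]
  have "(deriv ^^ n) (\<lambda>x. x ^ Suc m * w x) 0 = n * (deriv ^^ (n - 1)) (\<lambda>x. x ^ m * w x) 0"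
    by (simp add: mult.assoc)
  with Suc show ?case
    by (cases n) auto
qed simp

text \<open>
  Jets can be prescribed one order at a time because \<open>(u / (1 + u\<^sup>2)) ^ m\<close> vanishes at \<open>0\<close> to
  order exactly \<open>m\<close>. Boundedness is what later makes the diffeomorphism built from \<open>F\<close> surjective.
\<close>

lemma bounded_smooth_with_jet:
  fixes a :: "nat \<Rightarrow> real"
  shows "\<exists>F. smooth F \<and> bounded (range F) \<and> (\<forall>k<K. (deriv ^^ k) F 0 = a k)"
proof (induction K)
  case 0
  have "bounded (range (\<lambda>_::real. 0::real))"
    by (simp add: image_constant_conv)
  then show ?case
    using smooth_const by blast
next
  case (Suc K)
  then obtain F where F: "smooth F" "bounded (range F)" "\<And>k. k < K \<Longrightarrow> (deriv ^^ k) F 0 = a k"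
    by blast
  define w where "w u = inverse (1 + u * u) ^ K" for u :: real
  have pos_sq: "1 + u * u > 0" for u :: real
    by (simp add: add_pos_nonneg)
  have pos: "1 + u * u \<noteq> 0" for u :: real
    using pos_sq[of u] by simp
  have w: "smooth w"
    unfolding w_def[abs_def]
    by (intro smooth_power smooth_inverse smooth_add smooth_mult smooth_const smooth_ident pos)
  define h where "h u = u ^ K * w u" for u
  have h: "smooth h"
    unfolding h_def[abs_def] by (intro smooth_mult smooth_power smooth_ident w)
  have "\<bar>u\<bar> \<le> 1 + u * u" for u :: real
    using zero_le_square[of "\<bar>u\<bar> - 1"] by (simp add: algebra_simps)
  then have "\<bar>u * inverse (1 + u * u)\<bar> \<le> 1" for u :: real
    using pos_sq[of u] by (simp add: abs_mult divide_simps flip: divide_inverse)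
  then have "\<bar>h u\<bar> \<le> 1" for u
    unfolding h_def w_def power_mult_distrib[symmetric] power_abs by (intro power_le_one) auto
  then have "bounded (range h)"
    by (auto simp: bounded_iff)
  define c where "c = (a K - (deriv ^^ K) F 0) / fact K"
  let ?G = "\<lambda>u. F u + c * h u"
  have "smooth ?G"
    by (intro smooth_add smooth_mult smooth_const F h)
  moreover have "bounded (range ?G)"
  proof -
    obtain A where A: "\<And>u. \<bar>F u\<bar> \<le> A"
      using F(2) by (auto simp: bounded_iff)
    have "\<bar>?G u\<bar> \<le> A + \<bar>c\<bar>" for u
      using A[of u] mult_left_mono[OF \<open>\<bar>h u\<bar> \<le> 1\<close>, of "\<bar>c\<bar>"]
      by (intro order_trans[OF abs_triangle_ineq] add_mono) (auto simp: abs_mult)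
    then show ?thesis
      by (auto simp: bounded_iff)
  qed
  moreover have "(deriv ^^ k) ?G 0 = a k" if "k < Suc K" for k
  proof -
    have "(deriv ^^ k) h 0 = (if k = K then fact K else 0)"
      using funpow_deriv_power_mult_0[OF w, of k K] that by (auto simp: h_def[abs_def] w_def)
    moreover have "(deriv ^^ k) ?G 0 = (deriv ^^ k) F 0 + c * (deriv ^^ k) h 0"
      by (simp only: funpow_deriv_add_cmult[OF F(1) h])
    ultimately show ?thesis
      using that F(3)[of k] by (cases "k = K") (auto simp: c_def)
  qed
  ultimately show ?case
    by blast
qed

text \<open>
  Antiderivatives of \<open>exp \<circ> F\<close> are diffeomorphisms of the whole line: the derivative is bounded
  below by a positive constant, so the values are unbounded in both directions.
\<close>

lemma diffeo_with_log_deriv: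
  assumes F: "smooth F" "bounded (range F)"
  obtains \<phi> where "diffeo \<phi>" "deriv \<phi> = (\<lambda>u. exp (F u))"
proof -
  have sm: "smooth (\<lambda>u. exp (F u))"
    by (rule smooth_compose[OF smooth_exp F(1)])
  have "\<exists>\<phi>. \<forall>x::real. -\<infinity> < ereal x \<longrightarrow> ereal x < \<infinity> \<longrightarrow> (\<phi> has_vector_derivative exp (F x)) (at x)"
    using DERIV_isCont[OF smooth_DERIV[OF sm]] by (intro einterval_antiderivative) simp_all
  then obtain \<phi> where \<phi>: "\<And>x. (\<phi> has_real_derivative exp (F x)) (at x)"
    unfolding has_real_derivative_iff_has_vector_derivative by auto
  have deriv: "deriv \<phi> = (\<lambda>u. exp (F u))"
    by (intro ext DERIV_imp_deriv \<phi>)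
  have "smooth \<phi>"
  proof (rule smooth_coinduct[of _ "insert \<phi> {h. smooth h}"])
    fix h assume "h \<in> insert \<phi> {h. smooth h}"
    then have "h = \<phi> \<or> smooth h"
      by simp
    then have "smooth (deriv h) \<and> (\<forall>x. (h has_real_derivative deriv h x) (at x))"
      using \<phi> sm by (auto simp: deriv smooth_DERIV smooth_deriv)
    then show "\<exists>h'\<in>insert \<phi> {h. smooth h}. \<forall>x. (h has_real_derivative h' x) (at x)"
      by blast
  qed simp
  obtain B where B: "\<And>u. \<bar>F u\<bar> \<le> B"
    using F(2) by (auto simp: bounded_iff)
  define c where "c = exp (- B)"
  have "c > 0"
    by (simp add: c_def)
  have growth: "\<phi> y - \<phi> x \<ge> c * (y - x)" if "x \<le> y" for x y
  proof -
    have "\<phi> x - c * x \<le> \<phi> y - c * y"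
    proof (rule DERIV_nonneg_imp_nondecreasing[OF that])
      fix u
      have "((\<lambda>u. \<phi> u - c * u) has_real_derivative exp (F u) - c * 1) (at u)"
        by (intro DERIV_diff DERIV_cmult DERIV_ident \<phi>)
      moreover have "c \<le> exp (F u)"
        using B[of u] by (simp add: c_def abs_le_iff)
      ultimately show "\<exists>y. ((\<lambda>u. \<phi> u - c * u) has_real_derivative y) (at u) \<and> 0 \<le> y"
        by (intro exI[of _ "exp (F u) - c * 1"]) simp
    qed
    then show ?thesis
      by (simp add: algebra_simps)
  qed
  have less: "\<phi> x < \<phi> y" if "x < y" for x y
    using growth[of x y] that \<open>c > 0\<close> mult_pos_pos[of c "y - x"] by linarith
  then have inj: "inj \<phi>"
    by (intro injI) (metis less_irrefl linorder_less_linear)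
  have cont: "isCont \<phi> x" for x
    using \<phi> DERIV_isCont by blast
  have "\<exists>x. \<phi> x = y" for y
  proof -
    define d where "d = \<bar>y - \<phi> 0\<bar> / c"
    have d: "d \<ge> 0" "c * d = \<bar>y - \<phi> 0\<bar>"
      using \<open>c > 0\<close> by (auto simp: d_def)
    have "\<phi> (- d) \<le> y" "y \<le> \<phi> d"
      using growth[of "- d" 0] growth[of 0 d] d by auto
    then show ?thesis
      using IVT[of \<phi> "- d" y d] cont d by auto
  qed
  then have bij: "bij \<phi>"
    using inj by (metis bijI surjI)
  have "continuous_on UNIV (inv \<phi>)"
  proof -
    have "isCont (inv \<phi>) (\<phi> x)" for x
      by (rule isCont_inverse_function[of 1]) (use cont inj in auto)
    moreover have "\<phi> (inv \<phi> y) = y" for y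
      using bij by (simp add: bij_is_surj surj_f_inv_f)
    ultimately show ?thesis
      by (metis continuous_at_imp_continuous_on)
  qed
  then have ic: "isCont (inv \<phi>) y" for y
    by (simp add: continuous_on_eq_continuous_at)
  have "smooth (inv \<phi>)"
  proof (rule smooth_autonomous_ode)
    show "smooth (\<lambda>x. inverse (exp (F x)))"
      using sm by (intro smooth_inverse) auto
    show "(inv \<phi> has_real_derivative inverse (exp (F (inv \<phi> y)))) (at y)" for y
      by (rule DERIV_inverse_function[where f = \<phi> and a = "y - 1" and b = "y + 1"])
        (use \<phi> ic bij in \<open>auto simp: bij_is_surj surj_f_inv_f\<close>)
  qed
  then have "diffeo \<phi>"
    using bij \<open>smooth \<phi>\<close> by (simp add: diffeo_def)
  then show thesis
    using deriv by (rule that)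
qed

section \<open>Evaluation of polynomials and the derivation\<close>

lemma zpoly_eq_sum_monomials:
  "p = (\<Sum>\<beta>\<in>Poly_Mapping.keys p. Poly_Mapping.lookup p \<beta> *\<^sub>R zmon \<beta>)"
  by (rule poly_mapping_eqI)
    (auto simp: lookup_sum lookup_scaleR_poly zmon_def lookup_single when_def if_distrib in_keys_iff
      cong: if_cong)

lemma zmon_single: "zmon (Poly_Mapping.single x n) = Z x ^ n"
proof (induction n)
  case (Suc n)
  have "Poly_Mapping.single x (Suc n) = Poly_Mapping.single x 1 + Poly_Mapping.single x n"
    by (simp flip: single_add)
  then show ?case
    by (simp add: Suc Z_def flip: zmon_mult)
qed (simp add: zmon_def)

lemma zpoly_algebra_induct [case_names one var add mult scaleR]:
  fixes p :: zpoly
  assumes one: "P 1" and var: "\<And>x. P (Z x)" and add: "\<And>p q. P p \<Longrightarrow> P q \<Longrightarrow> P (p + q)"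
    and mult: "\<And>p q. P p \<Longrightarrow> P q \<Longrightarrow> P (p * q)" and scaleR: "\<And>c p. P p \<Longrightarrow> P (c *\<^sub>R p)"
  shows "P p"
proof -
  have mon: "P (zmon \<beta>)" for \<beta>
  proof (induction \<beta> rule: update_induct)
    case const
    then show ?case
      using one by (simp add: zmon_def)
  next
    case (update \<beta> x n)
    have "P (Z x ^ n)"
      by (induction n) (auto intro: one var mult)
    moreover have "Poly_Mapping.update x n \<beta> = Poly_Mapping.single x n + \<beta>"
      using update(1) by (intro poly_mapping_eqI)
        (auto simp: lookup_update lookup_add lookup_single when_def in_keys_iff)
    ultimately show ?case
      using update by (auto intro: mult simp: zmon_single simp flip: zmon_mult)
  qed
  show ?thesis
    by (induction p rule: zpoly_induct) (use scaleR[OF one, of 0] mon in \<open>auto intro: add scaleR\<close>)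
qed

lemma D_one: "Dz 1 = 0"
  using D_mult[of 1 1] by simp

lemma D_power: "Dz (p ^ Suc n) = real (Suc n) *\<^sub>R (p ^ n * Dz p)"
proof (induction n)
  case (Suc n)
  have "Dz (p ^ Suc (Suc n)) = Dz p * p ^ Suc n + p * Dz (p ^ Suc n)"
    by (simp add: D_mult)
  also have "\<dots> = 1 *\<^sub>R (p ^ Suc n * Dz p) + real (Suc n) *\<^sub>R (p ^ Suc n * Dz p)"
    unfolding Suc by (simp add: scaleR_mult_right_poly ac_simps)
  also have "\<dots> = real (Suc (Suc n)) *\<^sub>R (p ^ Suc n * Dz p)"
    by (simp only: of_nat_Suc[of "Suc n"] scaleR_add_left)
  finally show ?case .
qed simp

lemma F_0: "FF f g 0 u = 0"
  by (simp add: FF_def)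

lemma F_diff: "FF f g (p - q) u = FF f g p u - FF f g q u"
  using F_add[of f g "p - q" q u] by simp

lemma F_nabla:
  "FF f g (nabla v w) u = FF f g v u * (FF f g (Dz w) u + f u * FF f g w u)"
  by (simp add: nabla_def F_add F_mult F_scaleR F_Z algebra_simps)

lemma DERIV_FF:
  assumes "smooth f" "smooth g"
  shows "(FF f g p has_real_derivative FF f g (Dz p) u) (at u)"
proof (induction p arbitrary: u rule: zpoly_algebra_induct)
  case one
  have "FF f g 1 = (\<lambda>_. 1)"
    by (simp add: fun_eq_iff F_one)
  then show ?case
    by (simp add: D_one F_0)
next
  case (var x)
  have "FF f g (Z x) = F_var f g x"
    by (simp add: fun_eq_iff F_Z)
  moreover have "(F_var f g x has_real_derivative F_var f g (shift x) u) (at u)"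
  proof (cases x)
    case (Vee k)
    have "F_var f g x = (\<lambda>u. 2 * (deriv ^^ k) f u)"
      by (simp add: fun_eq_iff Vee)
    then show ?thesis
      using DERIV_cmult[OF DERIV_funpow_deriv[OF assms(1)], of 2 k u] by (simp add: Vee)
  next
    case (Circ k)
    have "F_var f g x = (deriv ^^ k) g"
      by (simp add: fun_eq_iff Circ)
    then show ?thesis
      using DERIV_funpow_deriv[OF assms(2), of k u] by (simp add: Circ)
  qed
  ultimately show ?case
    by (simp add: D_Z F_Z)
next
  case (add p q)
  have "FF f g (p + q) = (\<lambda>u. FF f g p u + FF f g q u)"
    by (simp add: fun_eq_iff F_add)
  then show ?case
    using DERIV_add[OF add] by (simp add: D_add F_add)
next
  case (mult p q)
  have "FF f g (p * q) = (\<lambda>u. FF f g p u * FF f g q u)"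
    by (simp add: fun_eq_iff F_mult)
  then show ?case
    using DERIV_mult[OF mult] by (simp add: D_mult F_mult F_add mult.commute)
next
  case (scaleR c p)
  have "FF f g (c *\<^sub>R p) = (\<lambda>u. c * FF f g p u)"
    by (simp add: fun_eq_iff F_scaleR)
  then show ?case
    using DERIV_cmult[OF scaleR] by (simp add: D_scaleR F_scaleR)
qed

section \<open>Monomials are linearly independent as functions\<close>

text \<open>
  For each exponent vector the map sending an assignment of real values to the value of the monomial
  is multiplicative, and distinct exponent vectors give distinct maps, so this is Artin's argument
  for the independence of characters: combining the relation at \<open>a \<cdot> b\<close> with a multiple of the
  relation at \<open>a\<close> removes one term.
\<close>

lemma monomial_functions_independent:
  fixes c :: "('v \<Rightarrow>\<^sub>0 nat) \<Rightarrow> real"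
  assumes "finite S"
    and "\<And>a::'v \<Rightarrow> real.
      (\<Sum>\<beta>\<in>S. c \<beta> * (\<Prod>x\<in>Poly_Mapping.keys \<beta>. a x ^ Poly_Mapping.lookup \<beta> x)) = 0"
    and "\<beta> \<in> S"
  shows "c \<beta> = 0"
  using assms
proof (induction S arbitrary: c \<beta> rule: finite_induct)
  case (insert \<gamma> S)
  define e where "e \<beta> a = (\<Prod>x\<in>Poly_Mapping.keys \<beta>. a x ^ Poly_Mapping.lookup \<beta> x)"
    for \<beta> :: "'v \<Rightarrow>\<^sub>0 nat" and a :: "'v \<Rightarrow> real"
  have rel: "c \<gamma> * e \<gamma> a + (\<Sum>\<beta>\<in>S. c \<beta> * e \<beta> a) = 0" for a
    using insert.prems(1)[of a] insert.hyps by (simp add: e_def)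
  have mult: "e \<beta> (\<lambda>x. a x * b x) = e \<beta> a * e \<beta> b" for \<beta> a b
    by (simp add: e_def power_mult_distrib prod.distrib)
  have S: "c \<beta> = 0" if "\<beta> \<in> S" for \<beta>
  proof -
    have "\<beta> \<noteq> \<gamma>"
      using that insert.hyps by blast
    then obtain x where x: "Poly_Mapping.lookup \<beta> x \<noteq> Poly_Mapping.lookup \<gamma> x"
      by (meson poly_mapping_eqI)
    define b :: "'v \<Rightarrow> real" where "b y = (if y = x then 2 else 1)" for y
    have eb: "e \<delta> b = 2 ^ Poly_Mapping.lookup \<delta> x" for \<delta>
    proof -
      have "e \<delta> b = (\<Prod>y\<in>Poly_Mapping.keys \<delta>. if y = x then 2 ^ Poly_Mapping.lookup \<delta> x else 1)"
        unfolding e_def by (intro prod.cong) (auto simp: b_def)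
      also have "\<dots> = 2 ^ Poly_Mapping.lookup \<delta> x"
        by (simp add: in_keys_iff)
      finally show ?thesis .
    qed
    have "c \<beta> * (e \<beta> b - e \<gamma> b) = 0"
    proof (rule insert.IH[where c = "\<lambda>\<beta>. c \<beta> * (e \<beta> b - e \<gamma> b)"])
      fix a :: "'v \<Rightarrow> real"
      have "(\<Sum>\<beta>\<in>S. c \<beta> * (e \<beta> b - e \<gamma> b) * e \<beta> a)
          = (\<Sum>\<beta>\<in>S. c \<beta> * e \<beta> (\<lambda>x. a x * b x)) - e \<gamma> b * (\<Sum>\<beta>\<in>S. c \<beta> * e \<beta> a)"
        by (simp add: mult sum_distrib_left algebra_simps flip: sum_subtractf)
      also have "\<dots> = - (c \<gamma> * e \<gamma> (\<lambda>x. a x * b x)) + e \<gamma> b * (c \<gamma> * e \<gamma> a)"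
        using rel[of a] rel[of "\<lambda>x. a x * b x"] by (simp add: add_eq_0_iff2)
      also have "\<dots> = 0"
        by (simp add: mult)
      finally show "(\<Sum>\<beta>\<in>S. c \<beta> * (e \<beta> b - e \<gamma> b) *
          (\<Prod>x\<in>Poly_Mapping.keys \<beta>. a x ^ Poly_Mapping.lookup \<beta> x)) = 0"
        by (simp add: e_def)
    qed (rule that)
    then show ?thesis
      using x by (simp add: eb)
  qed
  have "c \<gamma> = 0"
    using rel[of "\<lambda>_. 1"] S by (simp add: e_def)
  with S insert.prems show ?case
    by blast
qed simp

fun var_order :: "zvar \<Rightarrow> nat" where
  "var_order (Vee k) = k"
| "var_order (Circ k) = k"

text \<open>
  A polynomial involves only finitely many variables, hence only finitely many derivatives of
  \<open>f\<close> and \<open>g\<close> at \<open>0\<close>; it therefore suffices to prescribe jets up to each finite order \<open>K\<close>.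
\<close>

lemma zpoly_eq_0_of_jets:
  assumes "\<And>(a :: zvar \<Rightarrow> real) K. \<exists>f g.
    (\<forall>\<beta>\<in>Poly_Mapping.keys p. \<forall>x\<in>Poly_Mapping.keys \<beta>. var_order x < K \<longrightarrow> F_var f g x 0 = a x)
    \<and> FF f g p 0 = 0"
  shows "p = 0"
proof -
  let ?X = "\<Union>\<beta>\<in>Poly_Mapping.keys p. Poly_Mapping.keys \<beta>"
  have "finite (var_order ` ?X)"
    by simp
  then obtain K where K: "\<And>x. x \<in> ?X \<Longrightarrow> var_order x < K"
    unfolding finite_nat_set_iff_bounded by blast
  have "(\<Sum>\<beta>\<in>Poly_Mapping.keys p. Poly_Mapping.lookup p \<beta> *
      (\<Prod>x\<in>Poly_Mapping.keys \<beta>. a x ^ Poly_Mapping.lookup \<beta> x)) = 0" for a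
  proof -
    obtain f g where fg: "FF f g p 0 = 0" "\<And>\<beta> x. \<beta> \<in> Poly_Mapping.keys p \<Longrightarrow>
        x \<in> Poly_Mapping.keys \<beta> \<Longrightarrow> F_var f g x 0 = a x"
      using assms[of K a] K by blast
    have "FF f g p 0 = (\<Sum>\<beta>\<in>Poly_Mapping.keys p. Poly_Mapping.lookup p \<beta> *
        (\<Prod>x\<in>Poly_Mapping.keys \<beta>. a x ^ Poly_Mapping.lookup \<beta> x))"
      by (simp add: FF_def lin_ext_def fg cong: sum.cong prod.cong)
    with fg show ?thesis
      by simp
  qed
  then have "Poly_Mapping.lookup p \<beta> = 0" if "\<beta> \<in> Poly_Mapping.keys p" for \<beta>
    using monomial_functions_independent[OF finite_keys _ that] by blast
  then have "Poly_Mapping.keys p = {}"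
    by (meson equals0I in_keys_iff)
  then show ?thesis
    by simp
qed

section \<open>The bigrading by bracket and number of circles\<close>

lemma sum_lookup_add:
  fixes w :: "'v \<Rightarrow> 'a::comm_semiring_1" and \<alpha> \<beta> :: "'v \<Rightarrow>\<^sub>0 nat"
  shows "(\<Sum>x\<in>Poly_Mapping.keys (\<alpha> + \<beta>). w x * of_nat (Poly_Mapping.lookup (\<alpha> + \<beta>) x)) =
    (\<Sum>x\<in>Poly_Mapping.keys \<alpha>. w x * of_nat (Poly_Mapping.lookup \<alpha> x)) +
    (\<Sum>x\<in>Poly_Mapping.keys \<beta>. w x * of_nat (Poly_Mapping.lookup \<beta> x))"
proof -
  let ?S = "Poly_Mapping.keys \<alpha> \<union> Poly_Mapping.keys \<beta>"
  have ext: "(\<Sum>x\<in>Poly_Mapping.keys \<delta>. w x * of_nat (Poly_Mapping.lookup \<delta> x)) =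
      (\<Sum>x\<in>?S. w x * of_nat (Poly_Mapping.lookup \<delta> x))"
    if "Poly_Mapping.keys \<delta> \<subseteq> ?S" for \<delta>
    using that by (intro sum.mono_neutral_left) (auto simp: in_keys_iff)
  show ?thesis
    unfolding ext[OF Poly_Mapping.keys_add] ext[OF Un_upper1] ext[OF Un_upper2]
    by (simp add: lookup_add distrib_left sum.distrib)
qed

lemma circ_count_eq_weighted_sum:
  "circ_count \<beta> = (\<Sum>x\<in>Poly_Mapping.keys \<beta>. of_bool (is_circ x) * of_nat (Poly_Mapping.lookup \<beta> x))"
  unfolding circ_count_def by (intro sum.mono_neutral_cong_left) auto

lemma bracket_add: "bracket (\<alpha> + \<beta>) = bracket \<alpha> + bracket \<beta>"
  unfolding bracket_def by (rule sum_lookup_add)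

lemma circ_count_add: "circ_count (\<alpha> + \<beta>) = circ_count \<alpha> + circ_count \<beta>"
  unfolding circ_count_eq_weighted_sum by (rule sum_lookup_add)

lemma bracket_single: "bracket (Poly_Mapping.single x n) = var_degree x * int n"
  by (simp add: bracket_def)

lemma circ_count_single: "circ_count (Poly_Mapping.single x n) = (if is_circ x then n else 0)"
  by (simp add: circ_count_eq_weighted_sum)

text \<open>
  Only \<open>z\<^sub>(\<^sub>\<circ>\<^sub>,\<^sub>0\<^sub>)\<close> has positive degree, so a monomial of positive bracket contains it
  sufficiently often.
\<close>

lemma bracket_le_lookup_Circ_0: "bracket \<beta> \<le> int (Poly_Mapping.lookup \<beta> (Circ 0))"
proof -
  have "var_degree x \<le> of_bool (x = Circ 0)" for x
    by (cases x) auto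
  then have "bracket \<beta> \<le> (\<Sum>x\<in>Poly_Mapping.keys \<beta>. of_bool (x = Circ 0) * int (Poly_Mapping.lookup \<beta> x))"
    unfolding bracket_def by (intro sum_mono mult_right_mono) auto
  also have "\<dots> = (\<Sum>x\<in>Poly_Mapping.keys \<beta>. if x = Circ 0 then int (Poly_Mapping.lookup \<beta> (Circ 0)) else 0)"
    by (intro sum.cong) auto
  also have "\<dots> = int (Poly_Mapping.lookup \<beta> (Circ 0))"
    by (simp add: in_keys_iff)
  finally show ?thesis .
qed

lemma expo_split:
  fixes \<beta> :: zexpo
  assumes "n \<le> Poly_Mapping.lookup \<beta> x"
  obtains \<gamma> where "\<beta> = Poly_Mapping.single x n + \<gamma>"
proof
  show "\<beta> = Poly_Mapping.single x n + (\<beta> - Poly_Mapping.single x n)"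
    using assms by (intro poly_mapping_eqI) (auto simp: lookup_add lookup_minus lookup_single when_def)
qed

definition homogeneous :: "int \<Rightarrow> nat \<Rightarrow> zpoly set" where
  "homogeneous b n = {p. \<forall>\<beta>\<in>Poly_Mapping.keys p. bracket \<beta> = b \<and> circ_count \<beta> = n}"

lemma span_monomials:
  fixes P :: "zexpo \<Rightarrow> bool"
  shows "span {zmon \<beta> | \<beta>. P \<beta>} = {p. \<forall>\<beta>\<in>Poly_Mapping.keys p. P \<beta>}"
proof
  have "subspace {p :: zpoly. \<forall>\<beta>\<in>Poly_Mapping.keys p. P \<beta>}"
    using Poly_Mapping.keys_add
    by (fastforce simp: subspace_def in_keys_iff lookup_scaleR_poly lookup_add)
  then show "span {zmon \<beta> | \<beta>. P \<beta>} \<subseteq> {p. \<forall>\<beta>\<in>Poly_Mapping.keys p. P \<beta>}"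
    by (intro span_minimal) (auto simp: zmon_def)
  show "{p. \<forall>\<beta>\<in>Poly_Mapping.keys p. P \<beta>} \<subseteq> span {zmon \<beta> | \<beta>. P \<beta>}"
  proof
    fix p :: zpoly assume "p \<in> {p. \<forall>\<beta>\<in>Poly_Mapping.keys p. P \<beta>}"
    then have "(\<Sum>\<beta>\<in>Poly_Mapping.keys p. Poly_Mapping.lookup p \<beta> *\<^sub>R zmon \<beta>) \<in> span {zmon \<beta> | \<beta>. P \<beta>}"
      by (intro span_sum span_scale span_base) auto
    then show "p \<in> span {zmon \<beta> | \<beta>. P \<beta>}"
      using zpoly_eq_sum_monomials[of p] by simp
  qed
qed

lemma homogeneous_eq_span:
  "homogeneous b n = span {zmon \<beta> | \<beta>. bracket \<beta> = b \<and> circ_count \<beta> = n}"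
  by (simp add: span_monomials homogeneous_def)

lemma subspace_homogeneous: "subspace (homogeneous b n)"
  by (simp add: homogeneous_eq_span)

lemma zmon_homogeneous_iff: "zmon \<beta> \<in> homogeneous b n \<longleftrightarrow> bracket \<beta> = b \<and> circ_count \<beta> = n"
  by (simp add: homogeneous_def zmon_def)

lemma homogeneous_mult:
  assumes "p \<in> homogeneous b n" "q \<in> homogeneous c m"
  shows "p * q \<in> homogeneous (b + c) (n + m)"
  using assms keys_mult[of p q] by (fastforce simp: homogeneous_def bracket_add circ_count_add)

lemma homogeneous_D:
  assumes "p \<in> homogeneous b n"
  shows "Dz p \<in> homogeneous (b - 1) n"
proof -
  have "zmon (\<beta> - Poly_Mapping.single x 1 + Poly_Mapping.single (shift x) 1) \<in> homogeneous (b - 1) n"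
    if "\<beta> \<in> Poly_Mapping.keys p" "x \<in> Poly_Mapping.keys \<beta>" for \<beta> x
  proof -
    have "1 \<le> Poly_Mapping.lookup \<beta> x"
      using that(2) by (metis One_nat_def Suc_leI gr0I in_keys_iff)
    then obtain \<gamma> where \<gamma>: "\<beta> = Poly_Mapping.single x 1 + \<gamma>"
      by (rule expo_split)
    then have "\<beta> - Poly_Mapping.single x 1 = \<gamma>"
      by simp
    moreover have "var_degree (shift x) = var_degree x - 1" "is_circ (shift x) = is_circ x"
      by (cases x; simp)+
    ultimately show ?thesis
      using assms that(1) \<gamma>
      by (auto simp: homogeneous_def zmon_def bracket_add circ_count_add bracket_single circ_count_single)
  qed
  then show ?thesis
    unfolding Dz_def lin_ext_def D_zmon_def
    by (intro subspace_sum subspace_scale subspace_homogeneous) auto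
qed

lemma Z_homogeneous: "Z x \<in> homogeneous (var_degree x) (if is_circ x then 1 else 0)"
  by (simp add: Z_def zmon_homogeneous_iff bracket_single circ_count_single)

lemma homogeneous_nabla:
  assumes "v \<in> homogeneous 1 n" "w \<in> homogeneous 1 m"
  shows "nabla v w \<in> homogeneous 1 (n + m)"
  unfolding nabla_def
  using homogeneous_mult[OF assms(1) homogeneous_D[OF assms(2)]]
    homogeneous_mult[OF homogeneous_mult[OF Z_homogeneous[of "Vee 0"] assms(1)] assms(2)]
  by (intro subspace_add subspace_scale subspace_homogeneous) simp_all

section \<open>Geometric elements\<close>

definition geometric :: "zpoly \<Rightarrow> bool" where
  "geometric v \<longleftrightarrow> (\<forall>f g \<phi>. smooth f \<longrightarrow> smooth g \<longrightarrow> diffeo \<phi> \<longrightarrow>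
     homotopic_with_canon (\<lambda>_. True) UNIV UNIV \<phi> id \<longrightarrow>
     act_vec \<phi> (FF f g v) = FF (act_conn \<phi> f) (act_vec \<phi> g) v)"

lemma subspace_geometric: "subspace {v. geometric v}"
proof -
  have "FF f g 0 = (\<lambda>_. 0)" "FF f g (p + q) = (\<lambda>u. FF f g p u + FF f g q u)"
    "FF f g (c *\<^sub>R p) = (\<lambda>u. c * FF f g p u)" for f g p q c
    by (simp_all add: fun_eq_iff F_0 F_add F_scaleR)
  then show ?thesis
    by (auto simp: subspace_def geometric_def act_vec_def fun_eq_iff Let_def algebra_simps)
qed

lemma V_geo_N_eq: "V_geo_N N = {v \<in> homogeneous 1 N. geometric v}"
proof -
  have "V_geo = {v \<in> M_space. geometric v}"
    unfolding V_geo_def M_space_def geometric_def[symmetric]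
    using subspace_inter[OF subspace_span subspace_geometric] by (simp add: Int_def)
  then show ?thesis
    by (auto simp: V_geo_N_def M_space_def span_monomials homogeneous_def)
qed

lemma homotopic_to_id_real:
  fixes \<phi> :: "real \<Rightarrow> real"
  assumes "smooth \<phi>"
  shows "homotopic_with_canon (\<lambda>_. True) UNIV UNIV \<phi> id"
proof (rule homotopic_into_contractible)
  show "continuous_on UNIV \<phi>"
    using DERIV_isCont[OF smooth_DERIV[OF assms]] by (simp add: continuous_at_imp_continuous_on)
qed (auto intro: convex_imp_contractible)

lemma smooth_act_vec:
  assumes "diffeo \<phi>" "smooth g"
  shows "smooth (act_vec \<phi> g)"
proof -
  have "smooth (\<lambda>u. deriv \<phi> u * g u)" "smooth (inv \<phi>)"
    using assms by (auto simp: diffeo_def intro: smooth_mult smooth_deriv)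
  from smooth_compose[OF this] show ?thesis
    by (simp add: act_vec_def[abs_def] Let_def)
qed

lemma smooth_act_conn:
  assumes "diffeo \<phi>" "smooth f"
  shows "smooth (act_conn \<phi> f)"
proof -
  have \<phi>: "smooth \<phi>" "smooth (inv \<phi>)"
    using assms by (auto simp: diffeo_def)
  have "smooth (\<lambda>u. (deriv \<phi> u * f u - deriv (deriv \<phi>) u) * inverse (deriv \<phi> u ^ 2))"
    using diffeo_deriv_nonzero[OF assms(1)]
    by (intro smooth_mult smooth_diff smooth_inverse smooth_power smooth_deriv \<phi> assms) simp
  from smooth_compose[OF this \<phi>(2)] show ?thesis
    by (simp add: act_conn_def[abs_def] Let_def divide_inverse)
qed

text \<open>
  The term \<open>\<phi>''\<close> created by differentiating the transformed vector field \<open>\<phi>' w\<close> is exactly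
  cancelled by the inhomogeneous term in the transformation of \<open>f\<close>.
\<close>

lemma geometric_nabla:
  assumes "geometric v" "geometric w"
  shows "geometric (nabla v w)"
  unfolding geometric_def
proof (intro allI impI ext)
  fix f g \<phi> y
  assume f: "smooth f" and g: "smooth g" and \<phi>: "diffeo \<phi>"
    and hom: "homotopic_with_canon (\<lambda>_. True) UNIV UNIV \<phi> id"
  define F where "F = act_conn \<phi> f"
  define G where "G = act_vec \<phi> g"
  have transf: "FF F G x (\<phi> t) = deriv \<phi> t * FF f g x t" if "geometric x" for x t
    using that f g \<phi> hom act_vec_apply[OF \<phi>] unfolding geometric_def F_def G_def by metis
  obtain u where y: "y = \<phi> u"
    using \<phi> by (metis diffeo_def bij_pointE)
  have sm: "smooth \<phi>"
    using \<phi> by (simp add: diffeo_def)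
  have FG: "smooth F" "smooth G"
    using f g \<phi> by (simp_all add: F_def G_def smooth_act_conn smooth_act_vec)
  have "((\<lambda>t. FF F G w (\<phi> t)) has_real_derivative FF F G (Dz w) y * deriv \<phi> u) (at u)"
    unfolding y by (intro DERIV_chain2[OF DERIV_FF[OF FG] smooth_DERIV[OF sm]])
  moreover have "((\<lambda>t. FF F G w (\<phi> t)) has_real_derivative
      deriv (deriv \<phi>) u * FF f g w u + FF f g (Dz w) u * deriv \<phi> u) (at u)"
    unfolding transf[OF assms(2)]
    by (intro DERIV_mult DERIV_FF f g smooth_DERIV[OF smooth_deriv[OF sm]])
  ultimately have chain: "FF F G (Dz w) y * deriv \<phi> u =
      deriv (deriv \<phi>) u * FF f g w u + FF f g (Dz w) u * deriv \<phi> u"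
    by (rule DERIV_unique)
  have conn: "F y * (deriv \<phi> u)\<^sup>2 = deriv \<phi> u * f u - deriv (deriv \<phi>) u"
    unfolding F_def y by (rule act_conn_apply[OF \<phi>])
  have "(FF F G (Dz w) y + F y * (deriv \<phi> u * FF f g w u)) * deriv \<phi> u =
      FF F G (Dz w) y * deriv \<phi> u + (F y * (deriv \<phi> u)\<^sup>2) * FF f g w u"
    by (simp add: algebra_simps power2_eq_square)
  also have "\<dots> = (FF f g (Dz w) u + f u * FF f g w u) * deriv \<phi> u"
    unfolding chain conn by (simp add: algebra_simps)
  finally have "FF F G (Dz w) y + F y * (deriv \<phi> u * FF f g w u) =
      FF f g (Dz w) u + f u * FF f g w u"
    using diffeo_deriv_nonzero[OF \<phi>] by simp
  then have "FF F G (nabla v w) y = deriv \<phi> u * FF f g (nabla v w) u"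
    by (simp add: F_nabla transf[OF assms(1), of u, folded y] transf[OF assms(2), of u, folded y])
  then show "act_vec \<phi> (FF f g (nabla v w)) y = FF (act_conn \<phi> f) (act_vec \<phi> g) (nabla v w) y"
    using act_vec_apply[OF \<phi>] by (simp add: y F_def G_def)
qed

lemma geometric_Z_Circ_0: "geometric (Z (Circ 0))"
proof -
  have "FF f g (Z (Circ 0)) = g" for f g
    by (simp add: fun_eq_iff F_Z)
  then show ?thesis
    by (simp add: geometric_def)
qed

lemma BB_subset_V_geo_N: "BB N \<subseteq> V_geo_N N"
proof (induction N rule: BB.induct)
  case 2
  show ?case
    using Z_homogeneous[of "Circ 0"] geometric_Z_Circ_0 by (simp add: V_geo_N_eq)
next
  case (3 n)
  have "nabla v w \<in> V_geo_N (Suc (Suc n))"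
    if "k \<in> {1..Suc n}" "v \<in> BB k" "w \<in> BB (Suc (Suc n) - k)" for k v w
  proof -
    have "v \<in> V_geo_N k" "w \<in> V_geo_N (Suc (Suc n) - k)"
      using 3[of k] that by auto
    then show ?thesis
      using that(1) homogeneous_nabla[of v k w "Suc (Suc n) - k"] geometric_nabla[of v w]
      by (simp add: V_geo_N_eq)
  qed
  then show ?case
    by auto
qed simp

section \<open>Flat values determine geometric elements\<close>

text \<open>
  Equality of values at the connection \<open>f = 0\<close>. It is a congruence for the product and for \<open>D\<close>
  whose kernel contains every monomial with a variable of type \<open>\<or>\<close>.
\<close>

definition flat_eq :: "zpoly \<Rightarrow> zpoly \<Rightarrow> bool" where
  "flat_eq p q \<longleftrightarrow> (\<forall>g u. smooth g \<longrightarrow> FF (\<lambda>_. 0) g p u = FF (\<lambda>_. 0) g q u)"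

text \<open>
  In dimension one every connection is locally flat: \<open>\<phi> \<cdot> f = 0\<close> as soon as
  \<open>f = \<phi>'' / \<phi>' = (ln \<phi>')'\<close>. Taking \<open>\<phi>' = exp F\<close> with \<open>F\<close> bounded and of arbitrary jet at \<open>0\<close>
  realises arbitrary jets of \<open>f = F'\<close>, and there the equivariance of \<open>v\<close> reduces its value to
  one at the zero connection.
\<close>

lemma geometric_flat_zero:
  assumes "geometric v" "flat_eq v 0"
  shows "v = 0"
proof (rule zpoly_eq_0_of_jets)
  fix a :: "zvar \<Rightarrow> real" and K
  \<comment> \<open>The index is lowered by one because the connection is \<open>F'\<close>, not \<open>F\<close>, and the value is halved
    because \<open>Vee k\<close> is evaluated to twice the derivative.\<close>
  obtain F where F: "smooth F" "bounded (range F)"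
    "\<And>k. k < Suc K \<Longrightarrow> (deriv ^^ k) F 0 = a (Vee (k - 1)) / 2"
    using bounded_smooth_with_jet[of "Suc K" "\<lambda>k. a (Vee (k - 1)) / 2"] by blast
  obtain g where g: "smooth g" "\<And>k. k < K \<Longrightarrow> (deriv ^^ k) g 0 = a (Circ k)"
    using bounded_smooth_with_jet[of K "\<lambda>k. a (Circ k)"] by blast
  obtain \<phi> where \<phi>: "diffeo \<phi>" "deriv \<phi> = (\<lambda>u. exp (F u))"
    using diffeo_with_log_deriv[OF F(1,2)] .
  have "deriv (deriv \<phi>) u = exp (F u) * deriv F u" for u
    unfolding \<phi>(2) by (intro DERIV_imp_deriv DERIV_chain2[OF DERIV_exp smooth_DERIV[OF F(1)]])
  then have flat: "act_conn \<phi> (deriv F) = (\<lambda>_. 0)"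
    by (simp add: fun_eq_iff act_conn_def \<phi>(2) Let_def)
  have "act_vec \<phi> (FF (deriv F) g v) = FF (\<lambda>_. 0) (act_vec \<phi> g) v"
    using assms(1) F(1) g(1) \<phi>(1) homotopic_to_id_real[of \<phi>] smooth_deriv[OF F(1)]
    unfolding geometric_def flat[symmetric] by (simp add: diffeo_def)
  then have "deriv \<phi> 0 * FF (deriv F) g v 0 = FF (\<lambda>_. 0) (act_vec \<phi> g) v (\<phi> 0)"
    using act_vec_apply[OF \<phi>(1)] by metis
  also have "\<dots> = 0"
    using assms(2) smooth_act_vec[OF \<phi>(1) g(1)] by (simp add: flat_eq_def F_0)
  finally have "FF (deriv F) g v 0 = 0"
    by (simp add: \<phi>(2))
  moreover have "F_var (deriv F) g x 0 = a x" if "var_order x < K" for x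
    using that F(3)[of "Suc (var_order x)"] g(2)
    by (cases x) (simp_all add: funpow_Suc_right del: funpow.simps)
  ultimately show "\<exists>f g. (\<forall>\<beta>\<in>Poly_Mapping.keys v. \<forall>x\<in>Poly_Mapping.keys \<beta>.
      var_order x < K \<longrightarrow> F_var f g x 0 = a x) \<and> FF f g v 0 = 0"
    by blast
qed

definition circ_only :: "zexpo \<Rightarrow> bool" where
  "circ_only \<beta> \<longleftrightarrow> (\<forall>k. Poly_Mapping.lookup \<beta> (Vee k) = 0)"

lemma circ_only_flat_zero:
  assumes "\<And>\<beta>. \<beta> \<in> Poly_Mapping.keys p \<Longrightarrow> circ_only \<beta>" "flat_eq p 0"
  shows "p = 0"
proof (rule zpoly_eq_0_of_jets)
  fix a :: "zvar \<Rightarrow> real" and K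
  obtain g where g: "smooth g" "\<And>k. k < K \<Longrightarrow> (deriv ^^ k) g 0 = a (Circ k)"
    using bounded_smooth_with_jet[of K "\<lambda>k. a (Circ k)"] by blast
  have "F_var (\<lambda>_. 0) g x 0 = a x"
    if "\<beta> \<in> Poly_Mapping.keys p" "x \<in> Poly_Mapping.keys \<beta>" "var_order x < K" for \<beta> x
    using that assms(1)[of \<beta>] g(2) by (cases x) (auto simp: circ_only_def in_keys_iff)
  moreover have "FF (\<lambda>_. 0) g p 0 = 0"
    using assms(2) g(1) by (simp add: flat_eq_def F_0)
  ultimately show "\<exists>f g. (\<forall>\<beta>\<in>Poly_Mapping.keys p. \<forall>x\<in>Poly_Mapping.keys \<beta>.
      var_order x < K \<longrightarrow> F_var f g x 0 = a x) \<and> FF f g p 0 = 0"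
    by blast
qed

lemma flat_eq_vee_monomial:
  assumes "\<not> circ_only \<beta>"
  shows "flat_eq (zmon \<beta>) 0"
proof -
  obtain k where k: "Poly_Mapping.lookup \<beta> (Vee k) \<noteq> 0"
    using assms by (auto simp: circ_only_def)
  then have "Vee k \<in> Poly_Mapping.keys \<beta>"
    by (simp add: in_keys_iff)
  moreover have "F_var (\<lambda>_. 0) g (Vee k) u ^ Poly_Mapping.lookup \<beta> (Vee k) = 0" for g u
    using k by (simp add: funpow_deriv_zero)
  ultimately have "FF (\<lambda>_. 0) g (zmon \<beta>) u = 0" for g u
    unfolding FF_def lin_ext_zmon by (intro prod_zero finite_keys) blast
  then show ?thesis
    by (simp add: flat_eq_def F_0)
qed

lemma flat_eq_D:
  assumes "flat_eq p q"
  shows "flat_eq (Dz p) (Dz q)"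
  unfolding flat_eq_def
proof (intro allI impI)
  fix g u assume g: "smooth g"
  then have "FF (\<lambda>_. 0) g p = FF (\<lambda>_. 0) g q"
    using assms by (auto simp: flat_eq_def)
  then show "FF (\<lambda>_. 0) g (Dz p) u = FF (\<lambda>_. 0) g (Dz q) u"
    using DERIV_FF[OF smooth_const g, of 0 p u] DERIV_FF[OF smooth_const g, of 0 q u]
    by (auto intro: DERIV_unique)
qed

text \<open>
  Setting the variables of type \<open>\<or>\<close> to zero. On geometric elements this loses no information,
  so it will identify them with polynomials in the variables of type \<open>\<circ>\<close>.
\<close>

definition circ_part :: "zpoly \<Rightarrow> zpoly" where
  "circ_part = lin_ext (\<lambda>\<beta>. if circ_only \<beta> then zmon \<beta> else 0)"

lemma linear_circ_part: "linear circ_part"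
  by (intro linearI) (simp_all add: circ_part_def lin_ext_add lin_ext_scaleR)

lemma keys_circ_part:
  "Poly_Mapping.keys (circ_part p) \<subseteq> {\<beta> \<in> Poly_Mapping.keys p. circ_only \<beta>}"
proof -
  have "circ_part p \<in> span {zmon \<beta> | \<beta>. \<beta> \<in> Poly_Mapping.keys p \<and> circ_only \<beta>}"
    unfolding circ_part_def lin_ext_def
    by (intro span_sum span_scale) (auto intro: span_base simp: span_zero)
  then show ?thesis
    by (auto simp: span_monomials)
qed

lemma flat_eq_circ_part: "flat_eq (circ_part p) p"
proof (induction p rule: zpoly_induct)
  case (zmon c \<beta>)
  show ?case
    using flat_eq_vee_monomial[of \<beta>]
    by (auto simp: flat_eq_def circ_part_def lin_ext_scaleR F_scaleR F_0)
qed (auto simp: flat_eq_def linear_add[OF linear_circ_part] linear_0[OF linear_circ_part] F_add)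

section \<open>Covariant derivatives realise all flat values\<close>

lemma nabla_span:
  assumes "v \<in> span (BB j)" "w \<in> span (BB k)" "j \<ge> 1" "k \<ge> 1"
  shows "nabla v w \<in> span (BB (j + k))"
proof -
  have base: "nabla v w \<in> span (BB (j + k))" if "v \<in> BB j" "w \<in> BB k" for v w
  proof -
    have "BB (j + k) = {nabla v w | v w i. v \<in> BB i \<and> w \<in> BB (j + k - i) \<and> 1 \<le> i \<and> i \<le> j + k - 1}"
      using B_Suc[of "j + k - 1"] assms by simp
    moreover have "w \<in> BB (j + k - j)" "j \<le> j + k - 1"
      using that assms by auto
    ultimately show ?thesis
      using that assms by (intro span_base) blast
  qed
  have "linear (\<lambda>v. nabla v w)" for w
    by (intro linearI) (simp_all add: nabla_def algebra_simps scaleR_mult_left_poly scaleR_mult_right_poly)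
  then have "subspace {v. nabla v w \<in> span (BB (j + k))}" for w
    using linear_subspace_linear_preimage[OF _ subspace_span] by (auto simp: vimage_def)
  then have left: "nabla v w \<in> span (BB (j + k))" if "w \<in> BB k" for w
    using span_induct[OF assms(1), of "\<lambda>v. nabla v w \<in> span (BB (j + k))"] base that by blast
  have "linear (\<lambda>w. nabla v w)"
    by (intro linearI)
      (simp_all add: nabla_def algebra_simps D_add D_scaleR scaleR_mult_left_poly scaleR_mult_right_poly)
  then have "subspace {w. nabla v w \<in> span (BB (j + k))}"
    using linear_subspace_linear_preimage[OF _ subspace_span] by (auto simp: vimage_def)
  then show ?thesis
    using span_induct[OF assms(2), of "\<lambda>w. nabla v w \<in> span (BB (j + k))"] left by blast
qed

text \<open>
  Polynomials that agree at the zero connection with a combination of iterated covariant derivatives.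
  Working modulo \<^const>\<open>flat_eq\<close> lets the products below ignore all variables of type \<open>\<or>\<close>.
\<close>

definition flat_span :: "nat \<Rightarrow> zpoly set" where
  "flat_span N = {p. \<exists>w\<in>span (BB N). flat_eq p w}"

lemma flat_eq_add: "flat_eq p p' \<Longrightarrow> flat_eq q q' \<Longrightarrow> flat_eq (p + q) (p' + q')"
  and flat_eq_scaleR: "flat_eq p p' \<Longrightarrow> flat_eq (c *\<^sub>R p) (c *\<^sub>R p')"
  by (simp_all add: flat_eq_def F_add F_scaleR)

lemma subspace_flat_span: "subspace (flat_span N)"
  unfolding subspace_def flat_span_def
proof (intro conjI ballI allI; (elim CollectE bexE)?)
  show "0 \<in> {p. \<exists>w\<in>span (BB N). flat_eq p w}"
    using span_zero by (auto simp: flat_eq_def)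
qed (blast intro: flat_eq_add flat_eq_scaleR span_add span_scale)+

text \<open>
  At the connection \<open>f = 0\<close> the covariant derivative is \<open>v \<cdot> D w\<close>, which is the product of a
  Novikov algebra.
\<close>

lemma flat_span_mult_D:
  assumes "p \<in> flat_span j" "q \<in> flat_span k" "j \<ge> 1" "k \<ge> 1"
  shows "p * Dz q \<in> flat_span (j + k)"
proof -
  obtain v w where v: "v \<in> span (BB j)" "flat_eq p v" and w: "w \<in> span (BB k)" "flat_eq q w"
    using assms by (auto simp: flat_span_def)
  have "flat_eq (p * Dz q) (nabla v w)"
    using v(2) flat_eq_D[OF w(2)] by (simp add: flat_eq_def F_nabla F_mult)
  then show ?thesis
    using nabla_span[OF v(1) w(1) assms(3,4)] by (auto simp: flat_span_def)
qed

lemma circ_only_add: "circ_only (\<alpha> + \<beta>) \<longleftrightarrow> circ_only \<alpha> \<and> circ_only \<beta>"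
  by (auto simp: circ_only_def lookup_add)

lemma circ_only_single: "circ_only (Poly_Mapping.single (Circ k) n)"
  by (simp add: circ_only_def lookup_single)

lemma circ_only_cases:
  assumes "circ_only \<beta>"
  obtains (tail) k where "Poly_Mapping.lookup \<beta> (Circ (Suc k)) > 0"
  | (power) "\<beta> = Poly_Mapping.single (Circ 0) (Poly_Mapping.lookup \<beta> (Circ 0))"
proof (cases "\<exists>k. Poly_Mapping.lookup \<beta> (Circ (Suc k)) > 0")
  case False
  have "Poly_Mapping.lookup \<beta> x =
      Poly_Mapping.lookup (Poly_Mapping.single (Circ 0) (Poly_Mapping.lookup \<beta> (Circ 0))) x" for x
  proof (cases x)
    case (Circ k)
    then show ?thesis
      using False by (cases k) (auto simp: lookup_single when_def)
  qed (use assms in \<open>auto simp: circ_only_def lookup_single when_def\<close>)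
  then show ?thesis
    using power poly_mapping_eqI by blast
qed (use tail in blast)

text \<open>
  The one-generator free Novikov algebra consists of all differential monomials of bracket \<open>1\<close>.
  Writing \<open>z\<^sub>k\<close> for the circle variables, a monomial with a factor \<open>z\<^sub>k\<close>, \<open>k \<ge> 1\<close>, has the form
  \<open>m z\<^sub>0\<^sup>k\<^sup>-\<^sup>1 z\<^sub>k\<close> with \<open>m\<close> of bracket \<open>1\<close>, because the bracket forces enough factors \<open>z\<^sub>0\<close>. By
  the Leibniz rule it equals
  \<open>m \<cdot> D (z\<^sub>0\<^sup>k\<^sup>-\<^sup>1 z\<^sub>k\<^sub>-\<^sub>1) - (k - 1) (m z\<^sub>0\<^sup>k\<^sup>-\<^sup>2 z\<^sub>k\<^sub>-\<^sub>1) \<cdot> D z\<^sub>0\<close> for \<open>k \<ge> 2\<close> and \<open>m \<cdot> D z\<^sub>0\<close> for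
  \<open>k = 1\<close>, and \<open>m\<close> as well as the monomials in parentheses have fewer factors.
\<close>

lemma circ_monomial_in_flat_span:
  assumes "circ_only \<beta>" "bracket \<beta> = 1"
  shows "zmon \<beta> \<in> flat_span (circ_count \<beta>)"
  using assms
proof (induction "circ_count \<beta>" arbitrary: \<beta> rule: less_induct)
  case less
  let ?x = "\<lambda>k. Poly_Mapping.single (Circ k) (1 :: nat)"
  have z0: "Z (Circ 0) \<in> flat_span 1"
    using span_base[of "Z (Circ 0)" "BB 1"] by (auto simp: flat_span_def flat_eq_def)
  show ?case
    using less.prems(1)
  proof (cases rule: circ_only_cases)
    case power
    then have "bracket \<beta> = int (Poly_Mapping.lookup \<beta> (Circ 0))"
      by (metis bracket_single mult_1 of_nat_0 diff_zero var_degree.simps(1))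
    then have "\<beta> = ?x 0"
      using power less.prems(2) by simp
    then show ?thesis
      using z0 by (simp add: Z_def circ_count_single)
  next
    case (tail k)
    then obtain \<beta>' where \<beta>': "\<beta> = Poly_Mapping.single (Circ (Suc k)) 1 + \<beta>'"
      using expo_split[of 1 \<beta> "Circ (Suc k)"] by auto
    have "bracket \<beta>' = 1 + int k"
      using less.prems(2) by (simp add: \<beta>' bracket_add bracket_single)
    then have "k \<le> Poly_Mapping.lookup \<beta>' (Circ 0)"
      using bracket_le_lookup_Circ_0[of \<beta>'] by linarith
    then obtain \<mu> where \<mu>: "\<beta>' = Poly_Mapping.single (Circ 0) k + \<mu>"
      by (rule expo_split)
    have br: "bracket \<mu> = 1"
      using \<open>bracket \<beta>' = 1 + int k\<close> by (simp add: \<mu> bracket_add bracket_single)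
    have circ: "circ_only \<mu>"
      using less.prems(1) by (simp add: \<beta>' \<mu> circ_only_add)
    have count: "circ_count \<beta> = Suc k + circ_count \<mu>"
      by (simp add: \<beta>' \<mu> circ_count_add circ_count_single)
    have "1 \<le> Poly_Mapping.lookup \<mu> (Circ 0)"
      using bracket_le_lookup_Circ_0[of \<mu>] br by linarith
    then obtain \<nu> where "\<mu> = Poly_Mapping.single (Circ 0) 1 + \<nu>"
      by (rule expo_split)
    then have pos: "circ_count \<mu> \<ge> 1"
      by (simp add: circ_count_add circ_count_single)
    have m: "zmon \<mu> \<in> flat_span (circ_count \<mu>)"
      using less.hyps[of \<mu>] br circ count by simp
    have \<beta>: "zmon \<beta> = Z (Circ (Suc k)) * (Z (Circ 0) ^ k * zmon \<mu>)"
      by (simp add: \<beta>' \<mu> zmon_single flip: zmon_mult)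
    show ?thesis
    proof (cases k)
      case 0
      have "zmon \<beta> = zmon \<mu> * Dz (Z (Circ 0))"
        by (simp add: \<beta> 0 D_Z mult.commute)
      then show ?thesis
        using flat_span_mult_D[OF m z0 pos] by (simp add: count 0)
    next
      case (Suc j)
      define \<gamma> where "\<gamma> = Poly_Mapping.single (Circ 0) k + ?x k"
      define \<delta> where "\<delta> = \<mu> + Poly_Mapping.single (Circ 0) j + ?x k"
      have "zmon \<gamma> \<in> flat_span (Suc k)"
        using less.hyps[of \<gamma>] count pos
        by (simp add: \<gamma>_def circ_only_add circ_only_single bracket_add bracket_single
            circ_count_add circ_count_single)
      from flat_span_mult_D[OF m this pos] have A: "zmon \<mu> * Dz (zmon \<gamma>) \<in> flat_span (circ_count \<beta>)"
        by (simp add: count add.commute)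
      have "zmon \<delta> \<in> flat_span (circ_count \<mu> + k)"
        using less.hyps[of \<delta>] count circ br Suc
        by (simp add: \<delta>_def circ_only_add circ_only_single bracket_add bracket_single
            circ_count_add circ_count_single)
      from flat_span_mult_D[OF this z0] pos have B: "zmon \<delta> * Dz (Z (Circ 0)) \<in> flat_span (circ_count \<beta>)"
        by (simp add: count add.commute)
      have "Dz (zmon \<gamma>) = Dz (Z (Circ 0) ^ k) * Z (Circ k) + Z (Circ 0) ^ k * Z (Circ (Suc k))"
        by (simp add: \<gamma>_def zmon_single D_mult D_Z flip: zmon_mult)
      moreover have "Dz (Z (Circ 0) ^ k) = real k *\<^sub>R (Z (Circ 0) ^ j * Dz (Z (Circ 0)))"
        unfolding Suc by (rule D_power)
      moreover have "zmon \<delta> = zmon \<mu> * Z (Circ 0) ^ j * Z (Circ k)"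
        by (simp add: \<delta>_def zmon_single flip: zmon_mult)
      ultimately have "zmon \<beta> = zmon \<mu> * Dz (zmon \<gamma>) - real k *\<^sub>R (zmon \<delta> * Dz (Z (Circ 0)))"
        by (simp add: \<beta> algebra_simps scaleR_mult_left_poly scaleR_mult_right_poly)
      then show ?thesis
        using A B by (simp add: subspace_diff subspace_scale subspace_flat_span)
    qed
  qed
qed

lemma V_geo_N_flat_eq_imp_eq:
  assumes "v \<in> V_geo_N N" "w \<in> V_geo_N N" "flat_eq v w"
  shows "v = w"
proof -
  have "geometric (v - w)"
    using assms(1,2) subspace_diff[OF subspace_geometric] by (auto simp: V_geo_N_eq)
  moreover have "flat_eq (v - w) 0"
    using assms(3) by (simp add: flat_eq_def F_diff F_0)
  ultimately show ?thesis
    using geometric_flat_zero by fastforce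
qed

lemma subspace_V_geo_N: "subspace (V_geo_N N)"
  unfolding V_geo_N_def V_geo_def by (intro subspace_inter subspace_span)

text \<open>
  An iterated covariant derivative can be chosen with the same flat values as a given geometric
  element; both being geometric, they coincide.
\<close>

lemma span_BB_eq_V_geo_N: "span (BB N) = V_geo_N N"
proof
  show sub: "span (BB N) \<subseteq> V_geo_N N"
    by (intro span_minimal BB_subset_V_geo_N subspace_V_geo_N)
  show "V_geo_N N \<subseteq> span (BB N)"
  proof
    fix v assume v: "v \<in> V_geo_N N"
    have "zmon \<beta> \<in> flat_span N" if "\<beta> \<in> Poly_Mapping.keys (circ_part v)" for \<beta>
      using that keys_circ_part[of v] v circ_monomial_in_flat_span[of \<beta>]
      by (auto simp: V_geo_N_eq homogeneous_def)
    then have "circ_part v \<in> flat_span N"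
      by (subst zpoly_eq_sum_monomials) (intro subspace_sum subspace_scale subspace_flat_span)
    then obtain w where w: "w \<in> span (BB N)" "flat_eq (circ_part v) w"
      by (auto simp: flat_span_def)
    then have "flat_eq v w"
      using flat_eq_circ_part[of v] by (simp add: flat_eq_def)
    with v w(1) sub show "v \<in> span (BB N)"
      using V_geo_N_flat_eq_imp_eq by blast
  qed
qed

lemma inj_on_circ_part: "inj_on circ_part (V_geo_N N)"
proof (rule inj_onI)
  fix v w assume vw: "v \<in> V_geo_N N" "w \<in> V_geo_N N" and eq: "circ_part v = circ_part w"
  have "flat_eq v w"
    using flat_eq_circ_part[of v] flat_eq_circ_part[of w] unfolding eq by (simp add: flat_eq_def)
  with vw show "v = w"
    by (rule V_geo_N_flat_eq_imp_eq)
qed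

lemma M_circ_eq: "M_circ N = {zmon \<beta> | \<beta>. circ_only \<beta> \<and> bracket \<beta> = 1 \<and> circ_count \<beta> = N}"
  by (simp add: M_circ_def circ_only_def)

lemma circ_part_image_V_geo_N: "circ_part ` V_geo_N N = span (M_circ N)"
proof
  show "circ_part ` V_geo_N N \<subseteq> span (M_circ N)"
    using keys_circ_part by (fastforce simp: M_circ_eq span_monomials V_geo_N_eq homogeneous_def)
  have "p \<in> circ_part ` V_geo_N N" if p: "p \<in> M_circ N" for p
  proof -
    obtain \<beta> where \<beta>: "p = zmon \<beta>" "circ_only \<beta>" "bracket \<beta> = 1" "circ_count \<beta> = N"
      using p by (auto simp: M_circ_eq)
    then obtain w where w: "w \<in> V_geo_N N" "flat_eq p w"
      using circ_monomial_in_flat_span[of \<beta>] by (auto simp: flat_span_def span_BB_eq_V_geo_N)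
    have "circ_part w - p = 0"
    proof (rule circ_only_flat_zero)
      show "circ_only \<gamma>" if "\<gamma> \<in> Poly_Mapping.keys (circ_part w - p)" for \<gamma>
        using that keys_diff[of "circ_part w" p] keys_circ_part[of w] \<beta>(1,2) by (auto simp: zmon_def)
      show "flat_eq (circ_part w - p) 0"
        using flat_eq_circ_part[of w] w(2) by (simp add: flat_eq_def F_diff F_0)
    qed
    with w(1) show ?thesis
      by (metis eq_iff_diff_eq_0 image_eqI)
  qed
  then show "span (M_circ N) \<subseteq> circ_part ` V_geo_N N"
    by (intro span_minimal linear_subspace_image linear_circ_part subspace_V_geo_N) blast
qed

lemma independent_monomials: "independent {zmon \<beta> | \<beta>. P \<beta>}"
  unfolding dependent_def
proof clarify
  fix \<beta> assume \<beta>: "zmon \<beta> \<in> span ({zmon \<beta> | \<beta>. P \<beta>} - {zmon \<beta>})"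
  have "{zmon \<beta> | \<beta>. P \<beta>} - {zmon \<beta>} \<subseteq> {zmon \<gamma> | \<gamma>. \<gamma> \<noteq> \<beta>}"
    by auto
  with \<beta> have "zmon \<beta> \<in> span {zmon \<gamma> | \<gamma>. \<gamma> \<noteq> \<beta>}"
    using span_mono by blast
  then show False
    unfolding span_monomials by (simp add: zmon_def)
qed

text \<open>
  Setting the variables of type \<open>\<or>\<close> to zero carries a basis of the geometric elements to a basis
  of the span of the circle monomials.
\<close>

lemma dim_V_geo_N: "dim (V_geo_N N) = card (M_circ N)"
proof -
  obtain B where B: "B \<subseteq> V_geo_N N" "independent B" "V_geo_N N \<subseteq> span B" "card B = dim (V_geo_N N)"
    by (rule basis_exists)
  then have span_B: "span B = V_geo_N N"
    by (simp add: span_subspace subspace_V_geo_N)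
  have inj: "inj_on circ_part (span B)"
    unfolding span_B by (rule inj_on_circ_part)
  have "independent (circ_part ` B)"
    using inj by (intro linear_independent_injective_image linear_circ_part B(2))
  moreover have "span (circ_part ` B) = span (M_circ N)"
    by (simp add: linear_span_image linear_circ_part span_B circ_part_image_V_geo_N)
  ultimately have "dim (M_circ N) = card (circ_part ` B)"
    by (intro dim_eq_card)
  also have "\<dots> = dim (V_geo_N N)"
    using inj B(4) span_superset by (metis card_image inj_on_subset)
  finally show ?thesis
    using dim_eq_card_independent[OF independent_monomials] by (simp add: M_circ_eq)
qed

theorem theorem4p8:
  fixes N :: nat
  assumes "N \<ge> 2"
  shows "span (BB N) = V_geo_N N \<and> dim (V_geo_N N) = card (M_circ N)"
  using span_BB_eq_V_geo_N dim_V_geo_N by blast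

end
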